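(* Let $H$ be a graph without isolated vertices which is Gorenstein over $\mathbb{Q}$ and such that $\alpha(H)$ is odd, and let $v$ be a vertex of $H$. Then $G=\mathrm{Tr}(H,v)$ satisfies the Charney-Davis conjecture if and only if $H_v$ does so; that is, $$(-1)^{\alpha(G)/2}\,I\!\left(G,-\tfrac12\right)\ge 0\quad\text{if and only if}\quad(-1)^{\alpha(H_v)/2}\,I\!\left(H_v,-\tfrac12\right)\ge 0.$$
   Context: All graphs are finite, simple and undirected. For a graph $G$, $\alpha(G)$ is the maximum size of an independent set of $G$, and the independence polynomial of $G$ is $I(G,x)=\sum_{i=0}^{\alpha(G)}a_ix^i$, where $a_i$ is the number of independent sets of $G$ of size $i$ (the empty set is counted, so $a_0=1$). For a vertex $v$ of $H$, $H_v$ denotes the graph obtained from $H$ by deleting $v$ and all neighbors of $v$ (possibly the graph with no vertices, which has independence number $0$ and independence polynomial $1$). Trung's construction: for a graph $H$ and a non-isolated vertex $v$ of $H$, the graph $\mathrm{Tr}(H,v)$ is obtained from $H$ by adding three new vertices $a,b,c$ and the following edges: $c$ is joined to $b$ and to every neighbor of $v$ in $H$; $b$ is joined to $a$; and $a$ is joined to $v$. For a field $K$ and a graph $G$ with vertices $v_1,\ldots,v_n$, let $S=K[x_1,\ldots,x_n]$ and let $I(G)\subseteq S$ be the edge ideal, generated by all $x_ix_j$ with $v_iv_j$ an edge of $G$. The graph $G$ is called Gorenstein over $K$ if $S/I(G)$ is a Gorenstein ring. The Charney-Davis conjecture (in graph-theoretic form) says that $(-1)^{\alpha(G)/2}I(G,-1/2)\ge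 0$ for every graph $G$ with no isolated vertices which is Gorenstein over $\mathbb{Q}$ and has $\alpha(G)$ even; a graph $G$ with $\alpha(G)$ even satisfies the conjecture when this inequality holds for $G$. *)

theory Defs
  imports
    "HOL-Library.Poly_Mapping"
    "HOL-Library.Extended_Nat"
    "HOL-Computational_Algebra.Polynomial"
    "HOL-Algebra.QuotRing"
    "HOL-Algebra.Ring_Divisibility"
    "Graph_Theory.Pair_Digraph"
begin

section \<open>Graphs\<close>

text \<open>
  A finite simple undirected graph is a \<open>pair_graph\<close>: finite, loop-free, with a symmetric set
  of arcs, so that an edge \<open>{u, w}\<close> is represented by the two arcs \<open>(u, w)\<close> and \<open>(w, u)\<close>.
\<close>

definition neighbours :: "'a pair_pre_digraph \<Rightarrow> 'a \<Rightarrow> 'a set" where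
  "neighbours G v = {u. (v, u) \<in> parcs G}"

definition no_isolated_vertices :: "'a pair_pre_digraph \<Rightarrow> bool" where
  "no_isolated_vertices G \<longleftrightarrow> (\<forall>u \<in> pverts G. neighbours G u \<noteq> {})"

definition independent_sets :: "'a pair_pre_digraph \<Rightarrow> 'a set set" where
  "independent_sets G = {A. A \<subseteq> pverts G \<and> (\<forall>u \<in> A. \<forall>w \<in> A. (u, w) \<notin> parcs G)}"

definition independence_number :: "'a pair_pre_digraph \<Rightarrow> nat" where
  "independence_number G = Max (card ` independent_sets G)"

definition independence_poly :: "'a pair_pre_digraph \<Rightarrow> real poly" where
  "independence_poly G =
     (\<Sum>i\<le>independence_number G.
        Polynomial.monom (of_nat (card {A \<in> independent_sets G. card A = i})) i)"

definition delete_closed_nbhd :: "'a pair_pre_digraph \<Rightarrow> 'a \<Rightarrow> 'a pair_pre_digraph" where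
  "delete_closed_nbhd H v =
     (let W = pverts H - insert v (neighbours H v)
      in \<lparr>pverts = W, parcs = parcs H \<inter> W \<times> W\<rparr>)"

datatype 'a trung_vertex = Old 'a | New_a | New_b | New_c

definition trung :: "'a pair_pre_digraph \<Rightarrow> 'a \<Rightarrow> 'a trung_vertex pair_pre_digraph" where
  "trung H v =
     (let E = {(New_c, New_b), (New_b, New_a), (New_a, Old v)} \<union>
              (\<lambda>u. (New_c, Old u)) ` neighbours H v
      in \<lparr>pverts = Old ` pverts H \<union> {New_a, New_b, New_c},
          parcs = map_prod Old Old ` parcs H \<union> E \<union> E\<inverse>\<rparr>)"

text \<open>The inequality is only posed for graphs with even independence number; hence \<open>div\<close> is exact.\<close>

definition satisfies_charney_davis :: "'a pair_pre_digraph \<Rightarrow> bool" where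
  "satisfies_charney_davis G \<longleftrightarrow>
     even (independence_number G) \<and>
     (-1) ^ (independence_number G div 2) * poly (independence_poly G) (-1/2) \<ge> 0"


section \<open>Gorenstein rings\<close>

definition krull_dim :: "('a, 'b) ring_scheme \<Rightarrow> enat" where
  "krull_dim R =
     Sup {enat n | n. \<exists>P. (\<forall>i\<le>n. primeideal (P i) R) \<and> (\<forall>i<n. P i \<subset> P (Suc i))}"

definition local_ring :: "('a, 'b) ring_scheme \<Rightarrow> 'a set \<Rightarrow> bool" where
  "local_ring R M \<longleftrightarrow> cring R \<and> (\<forall>N. maximalideal N R \<longleftrightarrow> N = M)"

text \<open>
  The quantified condition says that \<open>xs ! i\<close> is a non-zero-divisor modulo its predecessors.
\<close>

definition regular_sequence :: "('a, 'b) ring_scheme \<Rightarrow> 'a list \<Rightarrow> bool" where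
  "regular_sequence R xs \<longleftrightarrow>
     set xs \<subseteq> carrier R \<and> Idl\<^bsub>R\<^esub> (set xs) \<noteq> carrier R \<and>
     (\<forall>i<length xs. \<forall>y \<in> carrier R.
        xs ! i \<otimes>\<^bsub>R\<^esub> y \<in> Idl\<^bsub>R\<^esub> (set (take i xs)) \<longrightarrow> y \<in> Idl\<^bsub>R\<^esub> (set (take i xs)))"

definition depth :: "('a, 'b) ring_scheme \<Rightarrow> 'a set \<Rightarrow> enat" where
  "depth R M = Sup {enat (length xs) | xs. set xs \<subseteq> M \<and> regular_sequence R xs}"

definition cohen_macaulay_local_ring :: "('a, 'b) ring_scheme \<Rightarrow> 'a set \<Rightarrow> bool" where
  "cohen_macaulay_local_ring R M \<longleftrightarrow>
     noetherian_ring R \<and> local_ring R M \<and> depth R M = krull_dim R"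

text \<open>
  As many elements of the maximal ideal as the dimension, generating an ideal primary to it,
  that is, one whose radical is the maximal ideal.
\<close>

definition system_of_parameters :: "('a, 'b) ring_scheme \<Rightarrow> 'a set \<Rightarrow> 'a list \<Rightarrow> bool" where
  "system_of_parameters R M xs \<longleftrightarrow>
     set xs \<subseteq> M \<and> enat (length xs) = krull_dim R \<and>
     (\<forall>y \<in> M. \<exists>n::nat. y [^]\<^bsub>R\<^esub> n \<in> Idl\<^bsub>R\<^esub> (set xs))"

definition irreducible_ideal :: "'a set \<Rightarrow> ('a, 'b) ring_scheme \<Rightarrow> bool" where
  "irreducible_ideal I R \<longleftrightarrow>
     ideal I R \<and> I \<noteq> carrier R \<and>
     (\<forall>J K. ideal J R \<and> ideal K R \<and> I = J \<inter> K \<longrightarrow> I = J \<or> I = K)"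

text \<open>
  Matsumura, \<^emph>\<open>Commutative Ring Theory\<close>, Section 18, defines a Gorenstein local ring to be a
  Noetherian local ring with any one of the equivalent properties listed in his Theorem 18.1.
  Among them are finite injective dimension and the one used here (property 5): the ring is
  Cohen--Macaulay and every ideal generated by a system of parameters is irreducible.
  It involves no modules other than ideals.
\<close>

definition gorenstein_local_ring :: "('a, 'b) ring_scheme \<Rightarrow> 'a set \<Rightarrow> bool" where
  "gorenstein_local_ring R M \<longleftrightarrow>
     cohen_macaulay_local_ring R M \<and>
     (\<forall>xs. system_of_parameters R M xs \<longrightarrow> irreducible_ideal (Idl\<^bsub>R\<^esub> (set xs)) R)"

text \<open>
  The localization \<open>S\<^sup>-\<^sup>1 R\<close>. The pair \<open>(a, s)\<close> stands for the fraction \<open>a / s\<close>; the factor \<open>u\<close>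
  is needed because \<open>R\<close> may have zero divisors.
\<close>

definition fraction_rel :: "('a, 'b) ring_scheme \<Rightarrow> 'a set \<Rightarrow> (('a \<times> 'a) \<times> ('a \<times> 'a)) set" where
  "fraction_rel R S =
     {((a, s), (b, t)). a \<in> carrier R \<and> s \<in> S \<and> b \<in> carrier R \<and> t \<in> S \<and>
        (\<exists>u \<in> S. u \<otimes>\<^bsub>R\<^esub> (t \<otimes>\<^bsub>R\<^esub> a) = u \<otimes>\<^bsub>R\<^esub> (s \<otimes>\<^bsub>R\<^esub> b))}"

definition fraction :: "('a, 'b) ring_scheme \<Rightarrow> 'a set \<Rightarrow> 'a \<Rightarrow> 'a \<Rightarrow> ('a \<times> 'a) set" where
  "fraction R S a s = fraction_rel R S `` {(a, s)}"

definition localization :: "('a, 'b) ring_scheme \<Rightarrow> 'a set \<Rightarrow> ('a \<times> 'a) set ring" where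
  "localization R S =
     \<lparr>carrier = (carrier R \<times> S) // fraction_rel R S,
      monoid.mult = (\<lambda>A B. \<Union>(a, s)\<in>A. \<Union>(b, t)\<in>B. fraction R S (a \<otimes>\<^bsub>R\<^esub> b) (s \<otimes>\<^bsub>R\<^esub> t)),
      one = fraction R S \<one>\<^bsub>R\<^esub> \<one>\<^bsub>R\<^esub>,
      zero = fraction R S \<zero>\<^bsub>R\<^esub> \<one>\<^bsub>R\<^esub>,
      add = (\<lambda>A B. \<Union>(a, s)\<in>A. \<Union>(b, t)\<in>B.
               fraction R S ((t \<otimes>\<^bsub>R\<^esub> a) \<oplus>\<^bsub>R\<^esub> (s \<otimes>\<^bsub>R\<^esub> b)) (s \<otimes>\<^bsub>R\<^esub> t))\<rparr>"

definition extended_ideal :: "('a, 'b) ring_scheme \<Rightarrow> 'a set \<Rightarrow> 'a set \<Rightarrow> ('a \<times> 'a) set set" where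
  "extended_ideal R S I = {fraction R S a s | a s. a \<in> I \<and> s \<in> S}"

definition gorenstein_ring :: "('a, 'b) ring_scheme \<Rightarrow> bool" where
  "gorenstein_ring R \<longleftrightarrow>
     cring R \<and> noetherian_ring R \<and>
     (\<forall>M. maximalideal M R \<longrightarrow>
        gorenstein_local_ring (localization R (carrier R - M))
          (extended_ideal R (carrier R - M) M))"


section \<open>Edge ideals and Gorenstein graphs\<close>

text \<open>
  The ring \<open>K[x\<^sub>u | u \<in> V]\<close>: a monomial is a finitely supported exponent function on the vertices,
  a polynomial a finitely supported coefficient function on the monomials.
\<close>

definition polynomial_ring :: "'a set \<Rightarrow> (('a \<Rightarrow>\<^sub>0 nat) \<Rightarrow>\<^sub>0 'k::field) ring" where
  "polynomial_ring V =
     \<lparr>carrier = {p. \<forall>m \<in> Poly_Mapping.keys p. Poly_Mapping.keys m \<subseteq> V},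
      monoid.mult = (*), one = 1, zero = 0, add = (+)\<rparr>"

definition var :: "'a \<Rightarrow> (('a \<Rightarrow>\<^sub>0 nat) \<Rightarrow>\<^sub>0 'k::field)" where
  "var u = Poly_Mapping.single (Poly_Mapping.single u 1) 1"

definition edge_ideal :: "'a pair_pre_digraph \<Rightarrow> (('a \<Rightarrow>\<^sub>0 nat) \<Rightarrow>\<^sub>0 'k::field) set" where
  "edge_ideal G = Idl\<^bsub>polynomial_ring (pverts G)\<^esub> {var u * var w | u w. (u, w) \<in> parcs G}"

definition edge_ring :: "'a pair_pre_digraph \<Rightarrow> (('a \<Rightarrow>\<^sub>0 nat) \<Rightarrow>\<^sub>0 'k::field) set ring" where
  "edge_ring G = polynomial_ring (pverts G) Quot edge_ideal G"

definition gorenstein_over :: "'k::field itself \<Rightarrow> 'a pair_pre_digraph \<Rightarrow> bool" where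
  "gorenstein_over K G \<longleftrightarrow> gorenstein_ring (edge_ring G :: (('a \<Rightarrow>\<^sub>0 nat) \<Rightarrow>\<^sub>0 'k) set ring)"

end

theory Submission
  imports Defs
begin

text \<open>
  Write \<open>G = Tr(H, v)\<close>. Sorting the independent sets of \<open>G\<close> by their intersection with the three new
  vertices gives
    \<open>I(G, x) = (1 + 2x) I(H, x) + x (1 + x) I(H\<^sub>v, x)\<close>,
  and \<open>\<alpha>(G) = \<alpha>(H) + 1\<close>. At \<open>x = -1/2\<close> the first summand vanishes and
  \<open>I(G, -1/2) = -I(H\<^sub>v, -1/2) / 4\<close>. If moreover \<open>\<alpha>(H\<^sub>v) = \<alpha>(H) - 1\<close>, then \<open>\<alpha>(G)/2 = \<alpha>(H\<^sub>v)/2 + 1\<close>,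
  so that the sign change is compensated and the two inequalities coincide up to the factor \<open>1/4\<close>.

  The equality \<open>\<alpha>(H\<^sub>v) = \<alpha>(H) - 1\<close> says that \<open>v\<close> lies in a maximum independent set. It holds because
  a Gorenstein ring is Cohen--Macaulay and a Cohen--Macaulay edge ring is unmixed: all maximal
  independent sets have the same size. To prove this, let \<open>L\<close> be the localization of the edge ring at
  the ideal generated by the variables, \<open>F\<close> a maximal independent set and \<open>A\<close> any independent set.

  Removing the elements of \<open>A\<close> one at a time gives a chain of primes generated by variables, so
  \<open>dim L \<ge> |A|\<close> (lemma \<open>card_le_krull_dim\<close>). On the other hand \<open>depth L \<le> |F|\<close> (lemma
  \<open>length_regular_sequence_le\<close>). Indeed, more than \<open>|F|\<close> elements are algebraically dependent modulo
  the prime \<open>P\<^sub>F\<close> generated by the variables outside \<open>F\<close> (lemma \<open>algebraic_dependence\<close>), and \<open>P\<^sub>F\<close>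
  annihilates the nonzero element \<open>\<Prod>\<^sub>u\<^sub>\<in>\<^sub>F x\<^sub>u\<close> of \<open>L\<close>. But in a Noetherian local ring a polynomial relation
  with unit coefficients between the members of a regular sequence cannot annihilate a nonzero
  element (lemma \<open>regular_modulo_independent\<close>). As depth and dimension agree, \<open>|A| \<le> |F|\<close>.

  The last two lemmas replace the usual argument through associated primes and the dimension of
  polynomial rings; they need only linear algebra and the ascending chain condition.
\<close>

section \<open>Independent sets of a graph and of its Trung construction\<close>

lemma finite_independent_sets:
  assumes "finite (pverts G)"
  shows "finite (independent_sets G)"
  using assms by (auto simp: independent_sets_def)

lemma empty_independent: "{} \<in> independent_sets G"
  by (auto simp: independent_sets_def)

lemma card_le_independence_number:
  assumes "finite (pverts G)" and "A \<in> independent_sets G"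
  shows "card A \<le> independence_number G"
  using assms finite_independent_sets[OF assms(1)] by (auto simp: independence_number_def)

lemma obtain_maximum_independent:
  assumes "finite (pverts G)"
  obtains A where "A \<in> independent_sets G" and "card A = independence_number G"
proof -
  have "independence_number G \<in> card ` independent_sets G"
    unfolding independence_number_def
    using finite_independent_sets[OF assms] empty_independent[of G] by (intro Max_in) auto
  then show ?thesis using that by auto
qed

lemma poly_independence_poly:
  assumes fin: "finite (pverts G)"
  shows "poly (independence_poly G) x = (\<Sum>A\<in>independent_sets G. x ^ card A)"
proof -
  let ?I = "independent_sets G" and ?n = "independence_number G"
  have "poly (independence_poly G) x = (\<Sum>i\<le>?n. real (card {A \<in> ?I. card A = i}) * x ^ i)"
    by (simp add: independence_poly_def poly_sum poly_monom)
  also have "\<dots> = (\<Sum>i\<le>?n. \<Sum>A | A \<in> ?I \<and> card A = i. x ^ card A)"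
    by (intro sum.cong refl) simp
  also have "\<dots> = (\<Sum>A\<in>?I. x ^ card A)"
    using finite_independent_sets[OF fin] card_le_independence_number[OF fin]
    by (intro sum.group) auto
  finally show ?thesis .
qed

lemma finite_pverts: "pair_graph G \<Longrightarrow> finite (pverts G)"
  by (simp add: pair_graph_def pair_digraph_def pair_fin_digraph_def pair_fin_digraph_axioms_def)

lemma arc_verts: "pair_graph G \<Longrightarrow> (u, w) \<in> parcs G \<Longrightarrow> u \<in> pverts G \<and> w \<in> pverts G"
  by (metis pair_graph.axioms(1) pair_digraph.axioms(1) pair_fin_digraph.axioms(1)
      pair_wf_digraph.in_arcsD1 pair_wf_digraph.in_arcsD2)

lemma arc_sym: "pair_graph G \<Longrightarrow> (u, w) \<in> parcs G \<Longrightarrow> (w, u) \<in> parcs G"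
  by (metis pair_graph.axioms(2) pair_pseudo_graph.axioms(2) pair_sym_digraph.pair_sym_arcs
      symD symmetric_conv with_proj_simps(3) arcs_ends_def symmetric_def)

lemma arc_neq: "pair_graph G \<Longrightarrow> (u, u) \<notin> parcs G"
  by (metis fst_conv pair_digraph.axioms(2) pair_graph.axioms(1)
      pair_loopfree_digraph.pair_no_loops snd_conv)

definition independent_avoiding :: "'a pair_pre_digraph \<Rightarrow> 'a set \<Rightarrow> 'a set set" where
  "independent_avoiding G N = {A \<in> independent_sets G. A \<inter> N = {}}"

lemma independent_sets_delete_closed_nbhd:
  "independent_sets (delete_closed_nbhd H v) = independent_avoiding H (insert v (neighbours H v))"
  by (auto simp: independent_sets_def delete_closed_nbhd_def Let_def independent_avoiding_def)

lemma independent_containing: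
  assumes H: "pair_graph H" and v: "v \<in> pverts H"
  shows "{A \<in> independent_sets H. v \<in> A}
       = insert v ` independent_sets (delete_closed_nbhd H v)"
proof (intro Set.set_eqI iffI)
  fix A assume A: "A \<in> {A \<in> independent_sets H. v \<in> A}"
  then have "A - {v} \<in> independent_sets (delete_closed_nbhd H v)"
    unfolding independent_sets_delete_closed_nbhd
    by (auto simp: independent_avoiding_def independent_sets_def neighbours_def)
  moreover have "A = insert v (A - {v})" using A by auto
  ultimately show "A \<in> insert v ` independent_sets (delete_closed_nbhd H v)" by blast
next
  fix A assume "A \<in> insert v ` independent_sets (delete_closed_nbhd H v)"
  then show "A \<in> {A \<in> independent_sets H. v \<in> A}"
    using arc_sym[OF H] arc_neq[OF H] v
    unfolding independent_sets_delete_closed_nbhd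
    by (auto simp: independent_avoiding_def independent_sets_def neighbours_def)
qed

lemma pverts_trung: "pverts (trung H v) = Old ` pverts H \<union> {New_a, New_b, New_c}"
  by (simp add: trung_def Let_def)

lemma parcs_trung:
  "(Old u, Old w) \<in> parcs (trung H v) \<longleftrightarrow> (u, w) \<in> parcs H"
  "(New_a, Old w) \<in> parcs (trung H v) \<longleftrightarrow> w = v"
  "(Old w, New_a) \<in> parcs (trung H v) \<longleftrightarrow> w = v"
  "(New_b, Old w) \<notin> parcs (trung H v)" "(Old w, New_b) \<notin> parcs (trung H v)"
  "(New_c, Old w) \<in> parcs (trung H v) \<longleftrightarrow> w \<in> neighbours H v"
  "(Old w, New_c) \<in> parcs (trung H v) \<longleftrightarrow> w \<in> neighbours H v"
  "(New_a, New_b) \<in> parcs (trung H v)" "(New_b, New_c) \<in> parcs (trung H v)"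
  "(New_a, New_c) \<notin> parcs (trung H v)" "(New_c, New_a) \<notin> parcs (trung H v)"
  "(New_a, New_a) \<notin> parcs (trung H v)" "(New_b, New_b) \<notin> parcs (trung H v)"
  "(New_c, New_c) \<notin> parcs (trung H v)"
  by (auto simp: trung_def Let_def)

text \<open>
  The new vertices form the path \<open>a - b - c\<close>, whose independent sets are \<open>{}\<close>, \<open>{b}\<close>, \<open>{a}\<close>, \<open>{c}\<close> and
  \<open>{a, c}\<close>. Choosing \<open>a\<close> excludes \<open>v\<close>, and choosing \<open>c\<close> excludes the neighbours of \<open>v\<close>.
\<close>

lemma independent_sets_trung:
  assumes H: "pair_graph H" and v: "v \<in> pverts H"
  defines "N \<equiv> neighbours H v"
  shows "independent_sets (trung H v) =
      image Old ` independent_avoiding H {}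
    \<union> (insert New_b \<circ> image Old) ` independent_avoiding H {}
    \<union> (insert New_a \<circ> image Old) ` independent_avoiding H {v}
    \<union> (insert New_c \<circ> image Old) ` independent_avoiding H N
    \<union> (insert New_a \<circ> insert New_c \<circ> image Old) ` independent_avoiding H (insert v N)"
    (is "_ = ?R")
proof (intro Set.set_eqI iffI)
  fix A assume A: "A \<in> independent_sets (trung H v)"
  define B where "B = {u. Old u \<in> A}"
  have "(u, w) \<notin> parcs H" if "u \<in> B" "w \<in> B" for u w
    using A that parcs_trung(1)[of u w H v] by (auto simp: B_def independent_sets_def)
  then have B: "B \<in> independent_sets H"
    using A by (auto simp: B_def independent_sets_def pverts_trung)
  have nadj: "(u, w) \<notin> parcs (trung H v)" if "u \<in> A" "w \<in> A" for u w
    using A that by (auto simp: independent_sets_def)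
  have ab: "\<not> (New_a \<in> A \<and> New_b \<in> A)" using nadj parcs_trung(8) by metis
  have bc: "\<not> (New_b \<in> A \<and> New_c \<in> A)" using nadj parcs_trung(9) by metis
  have av: "\<not> (New_a \<in> A \<and> v \<in> B)" unfolding B_def using nadj parcs_trung(2) by (metis mem_Collect_eq)
  have cN: "B \<inter> N = {}" if "New_c \<in> A"
    using nadj[OF that] parcs_trung(6)[where H = H and v = v] unfolding B_def N_def by blast
  define C where "C = A \<inter> {New_a, New_b, New_c}"
  have AB: "A = Old ` B \<union> C"
  proof (rule Set.set_eqI)
    fix w show "w \<in> A \<longleftrightarrow> w \<in> Old ` B \<union> C"
      by (cases w) (auto simp: B_def C_def)
  qed
  have "C = {} \<or> C = {New_b} \<or> C = {New_a} \<or> C = {New_c} \<or> C = {New_a, New_c}"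
    using ab bc by (cases "New_a \<in> A"; cases "New_b \<in> A"; cases "New_c \<in> A") (simp_all add: C_def)
  then consider "A = Old ` B" | "A = insert New_b (Old ` B)" | "A = insert New_a (Old ` B)" "New_a \<in> A"
    | "A = insert New_c (Old ` B)" "New_c \<in> A"
    | "A = insert New_a (insert New_c (Old ` B))" "New_a \<in> A" "New_c \<in> A"
    unfolding AB by auto
  then show "A \<in> ?R"
  proof cases
    case 1
    then show ?thesis using B by (auto simp: independent_avoiding_def)
  next
    case 2
    then show ?thesis using B by (auto simp: independent_avoiding_def)
  next
    case 3
    then have "B \<in> independent_avoiding H {v}" using B av by (auto simp: independent_avoiding_def)
    then show ?thesis using 3 by auto
  next
    case 4
    then have "B \<in> independent_avoiding H N" using B cN by (auto simp: independent_avoiding_def)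
    then show ?thesis using 4 by auto
  next
    case 5
    then have "B \<in> independent_avoiding H (insert v N)"
      using B cN av by (auto simp: independent_avoiding_def)
    then show ?thesis using 5 by auto
  qed
next
  fix A assume "A \<in> ?R"
  then show "A \<in> independent_sets (trung H v)"
    unfolding independent_avoiding_def independent_sets_def N_def
    by (elim UnE; auto simp: parcs_trung pverts_trung)
qed

lemma sum_independent_sets_trung:
  fixes x :: real
  assumes H: "pair_graph H" and v: "v \<in> pverts H"
  defines "N \<equiv> neighbours H v"
  defines "W \<equiv> \<lambda>M. \<Sum>A\<in>independent_avoiding H M. x ^ card A"
  shows "(\<Sum>A\<in>independent_sets (trung H v). x ^ card A)
    = W {} + x * W {} + x * W {v} + x * W N + x ^ 2 * W (insert v N)"
proof -
  have fin: "finite (independent_avoiding H M)" for M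
    using finite_independent_sets[OF finite_pverts[OF H]] by (auto simp: independent_avoiding_def)
  have finA: "finite A" if "A \<in> independent_avoiding H M" for A M
    using that finite_pverts[OF H] by (auto simp: independent_avoiding_def independent_sets_def
        intro: finite_subset)
  have inj0: "inj_on (image Old) X" for X :: "'a set set"
    by (rule inj_on_image) (auto simp: inj_on_def)
  have inj1: "inj_on (insert w \<circ> image Old) X" if "w \<notin> range Old" for w and X :: "'a set set"
  proof (rule inj_onI)
    fix A B assume "(insert w \<circ> image Old) A = (insert w \<circ> image Old) B"
    then have "insert w (Old ` A) = insert w (Old ` B)" by simp
    then have "{u. Old u \<in> insert w (Old ` A)} = {u. Old u \<in> insert w (Old ` B)}" by simp
    moreover have "{u. Old u \<in> insert w (Old ` A)} = A" for A using that by auto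
    ultimately show "A = B" by simp
  qed
  have inj2: "inj_on (insert New_a \<circ> insert New_c \<circ> image Old) X" for X :: "'a set set"
  proof (rule inj_onI)
    fix A B assume "(insert New_a \<circ> insert New_c \<circ> image Old) A = (insert New_a \<circ> insert New_c \<circ> image Old) B"
    then have "{u. Old u \<in> insert New_a (insert New_c (Old ` A))} = {u. Old u \<in> insert New_a (insert New_c (Old ` B))}"
      by simp
    then show "A = B" by auto
  qed
  have c0: "card (Old ` A) = card A" for A :: "'a set"
    by (intro card_image) (auto simp: inj_on_def)
  have s0: "(\<Sum>A\<in>image Old ` independent_avoiding H M. x ^ card A) = W M" for M
    unfolding W_def by (subst sum.reindex[OF inj0]) (simp add: c0)
  have s1: "(\<Sum>A\<in>(insert w \<circ> image Old) ` independent_avoiding H M. x ^ card A) = x * W M"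
    if "w \<notin> range Old" for w M
    unfolding W_def sum_distrib_left
    by (subst sum.reindex[OF inj1[OF that]]) (use that in \<open>auto intro!: sum.cong simp: c0 finA card_insert_if\<close>)
  have s2: "(\<Sum>A\<in>(insert New_a \<circ> insert New_c \<circ> image Old) ` independent_avoiding H M. x ^ card A)
      = x ^ 2 * W M" for M
    unfolding W_def sum_distrib_left
    by (subst sum.reindex[OF inj2])
      (auto intro!: sum.cong simp: c0 finA card_insert_if power2_eq_square)
  define S0 where "S0 = image Old ` independent_avoiding H {}"
  define S1 where "S1 = (insert New_b \<circ> image Old) ` independent_avoiding H {}"
  define S2 where "S2 = (insert New_a \<circ> image Old) ` independent_avoiding H {v}"
  define S3 where "S3 = (insert New_c \<circ> image Old) ` independent_avoiding H N"
  define S4 where "S4 = (insert New_a \<circ> insert New_c \<circ> image Old) ` independent_avoiding H (insert v N)"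
  have finS: "finite S0" "finite S1" "finite S2" "finite S3" "finite S4"
    by (simp_all add: S0_def S1_def S2_def S3_def S4_def fin)
  have "S0 \<inter> S1 = {}" "(S0 \<union> S1) \<inter> S2 = {}" "(S0 \<union> S1 \<union> S2) \<inter> S3 = {}"
    "(S0 \<union> S1 \<union> S2 \<union> S3) \<inter> S4 = {}"
    unfolding S0_def S1_def S2_def S3_def S4_def by auto
  then have "(\<Sum>A\<in>S0 \<union> S1 \<union> S2 \<union> S3 \<union> S4. x ^ card A)
     = (\<Sum>A\<in>S0. x ^ card A) + (\<Sum>A\<in>S1. x ^ card A) + (\<Sum>A\<in>S2. x ^ card A)
     + (\<Sum>A\<in>S3. x ^ card A) + (\<Sum>A\<in>S4. x ^ card A)"
    using finS by (simp add: sum.union_disjoint)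
  moreover have "independent_sets (trung H v) = S0 \<union> S1 \<union> S2 \<union> S3 \<union> S4"
    unfolding S0_def S1_def S2_def S3_def S4_def N_def by (rule independent_sets_trung[OF H v])
  moreover have "(\<Sum>A\<in>S1. x ^ card A) = x * W {}" "(\<Sum>A\<in>S2. x ^ card A) = x * W {v}"
    "(\<Sum>A\<in>S3. x ^ card A) = x * W N"
    unfolding S1_def S2_def S3_def by (rule s1; auto)+
  moreover have "(\<Sum>A\<in>S0. x ^ card A) = W {}" "(\<Sum>A\<in>S4. x ^ card A) = x ^ 2 * W (insert v N)"
    unfolding S0_def S4_def by (rule s0 s2)+
  ultimately show ?thesis by simp
qed

text \<open>
  The five families of independent sets contribute \<open>W(\<emptyset>)\<close>, \<open>x W(\<emptyset>)\<close>, \<open>x W(v)\<close>, \<open>x W(N)\<close> and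
  \<open>x\<^sup>2 W(N \<union> v)\<close>, where \<open>W(M)\<close> is the sum of \<open>x\<^bsup>|A|\<^esup>\<close> over the independent sets \<open>A\<close> of \<open>H\<close> avoiding
  \<open>M\<close>, and \<open>N\<close> is the neighbourhood of \<open>v\<close>. Both \<open>W(v) = W(\<emptyset>) - x W(N \<union> v)\<close> and \<open>W(N) = (1 + x) W(N \<union> v)\<close> follow by
  asking whether \<open>v\<close> is chosen; in the second case \<open>v\<close> can always be added, having no neighbour left.
\<close>

theorem independence_poly_trung:
  assumes H: "pair_graph H" and v: "v \<in> pverts H"
  shows "poly (independence_poly (trung H v)) x
    = (1 + 2 * x) * poly (independence_poly H) x
      + x * (1 + x) * poly (independence_poly (delete_closed_nbhd H v)) x"
proof -
  define N where "N = neighbours H v"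
  define W where "W = (\<lambda>M. \<Sum>A\<in>independent_avoiding H M. x ^ card A)"
  have finH: "finite (pverts H)" by (rule finite_pverts[OF H])
  have fin: "finite (independent_avoiding H M)" for M
    using finite_independent_sets[OF finH] by (auto simp: independent_avoiding_def)
  have finA: "finite A" if "A \<in> independent_avoiding H M" for A M
    using that finH by (auto simp: independent_avoiding_def independent_sets_def intro: finite_subset)
  have vN: "v \<notin> N" using arc_neq[OF H] by (auto simp: N_def neighbours_def)
  have cont: "insert v ` independent_avoiding H (insert v N) = {A \<in> independent_sets H. v \<in> A}"
    using independent_containing[OF H v] by (simp add: independent_sets_delete_closed_nbhd N_def)
  have sum_cont: "(\<Sum>A\<in>insert v ` independent_avoiding H (insert v N). x ^ card A) = x * W (insert v N)"
    unfolding W_def sum_distrib_left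
  proof (subst sum.reindex)
    show "inj_on (insert v) (independent_avoiding H (insert v N))"
      by (auto simp: inj_on_def independent_avoiding_def)
  qed (auto intro!: sum.cong simp: finA card_insert_if independent_avoiding_def independent_sets_def
        intro: finite_subset[OF _ finH])
  have e1: "independent_avoiding H {} = independent_avoiding H {v} \<union> insert v ` independent_avoiding H (insert v N)"
    unfolding cont by (auto simp: independent_avoiding_def)
  have W1: "W {} = W {v} + x * W (insert v N)"
    unfolding sum_cont[symmetric] unfolding W_def e1
    by (rule sum.union_disjoint) (auto simp: fin, auto simp: independent_avoiding_def)
  have e2: "independent_avoiding H N = independent_avoiding H (insert v N) \<union> insert v ` independent_avoiding H (insert v N)"
  proof (intro Set.set_eqI iffI)
    fix A assume A: "A \<in> independent_avoiding H N"
    show "A \<in> independent_avoiding H (insert v N) \<union> insert v ` independent_avoiding H (insert v N)"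
      unfolding cont using A by (auto simp: independent_avoiding_def)
  next
    fix A assume A: "A \<in> independent_avoiding H (insert v N) \<union> insert v ` independent_avoiding H (insert v N)"
    have "A \<inter> N = {}" using A vN by (auto simp: independent_avoiding_def)
    moreover have "A \<in> independent_sets H" using A unfolding cont by (auto simp: independent_avoiding_def)
    ultimately show "A \<in> independent_avoiding H N" by (auto simp: independent_avoiding_def)
  qed
  have W2: "W N = W (insert v N) + x * W (insert v N)"
    unfolding sum_cont[symmetric] unfolding W_def
    by (subst e2, rule sum.union_disjoint) (auto simp: fin, auto simp: independent_avoiding_def)
  have G: "poly (independence_poly (trung H v)) x = W {} + x * W {} + x * W {v} + x * W N + x ^ 2 * W (insert v N)"
  proof -
    have "finite (pverts (trung H v))" using finH by (simp add: trung_def Let_def)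
    then show ?thesis
      using sum_independent_sets_trung[OF H v] by (simp add: poly_independence_poly W_def N_def)
  qed
  have PH: "poly (independence_poly H) x = W {}"
    by (simp add: poly_independence_poly[OF finH] W_def independent_avoiding_def)
  have Pv: "poly (independence_poly (delete_closed_nbhd H v)) x = W (insert v N)"
    using finH by (subst poly_independence_poly)
      (auto simp: delete_closed_nbhd_def Let_def W_def independent_sets_delete_closed_nbhd[unfolded delete_closed_nbhd_def Let_def] N_def)
  show ?thesis
    unfolding G PH Pv W2 using W1 by (simp add: algebra_simps power2_eq_square)
qed

text \<open>
  The value is attained by adding \<open>b\<close> to a maximum independent set of \<open>H\<close>. Conversely, an independent
  set containing two new vertices contains \<open>a\<close> and \<open>c\<close>; its old part avoids \<open>v\<close> and the neighbours of
  \<open>v\<close>, so that \<open>v\<close> may be added to it in \<open>H\<close>.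
\<close>

lemma independence_number_trung:
  assumes H: "pair_graph H" and v: "v \<in> pverts H"
  shows "independence_number (trung H v) = Suc (independence_number H)"
proof -
  let ?n = "independence_number H"
  have finH: "finite (pverts H)" by (rule finite_pverts[OF H])
  have finG: "finite (pverts (trung H v))" using finH by (simp add: trung_def Let_def)
  have finA: "finite A" if "A \<in> independent_sets H" for A
    using that finH by (auto simp: independent_sets_def intro: finite_subset)
  have c0: "card (Old ` A) = card A" for A :: "'a set"
    by (intro card_image) (auto simp: inj_on_def)
  have le: "card A \<le> Suc ?n" if A: "A \<in> independent_sets (trung H v)" for A
  proof -
    have le1: "card (insert w (Old ` B)) \<le> Suc ?n" if "B \<in> independent_sets H" for w B
      using card_le_independence_number[OF finH that] card_insert_le_m1[of "Suc ?n" "Old ` B" w]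
      by (simp add: c0 card_insert_if finA[OF that])
    have le2: "card (insert New_a (insert New_c (Old ` B))) \<le> Suc ?n"
      if B: "B \<in> independent_avoiding H (insert v (neighbours H v))" for B
    proof -
      have "insert v B \<in> independent_sets H"
        using independent_containing[OF H v] B unfolding independent_sets_delete_closed_nbhd by blast
      then have "card (insert v B) \<le> ?n" by (rule card_le_independence_number[OF finH])
      moreover have "finite B" "v \<notin> B" using B finA by (auto simp: independent_avoiding_def)
      ultimately have "Suc (card B) \<le> ?n" by simp
      then show ?thesis using \<open>finite B\<close> by (simp add: card_insert_if c0 image_iff)
    qed
    have le0: "card (Old ` B) \<le> Suc ?n" if "B \<in> independent_sets H" for B
      using card_le_independence_number[OF finH that] by (simp add: c0)
    show ?thesis
      using A le0 le1 le2 unfolding independent_sets_trung[OF H v]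
      by (auto simp: independent_avoiding_def)
  qed
  obtain A where A: "A \<in> independent_sets H" "card A = ?n"
    by (rule obtain_maximum_independent[OF finH])
  have "insert New_b (Old ` A) \<in> independent_sets (trung H v)"
    using A unfolding independent_sets_trung[OF H v] by (auto simp: independent_avoiding_def)
  then have "card (insert New_b (Old ` A)) \<le> independence_number (trung H v)"
    by (rule card_le_independence_number[OF finG])
  moreover have "card (insert New_b (Old ` A)) = Suc ?n"
    using A finA by (simp add: card_insert_if c0 image_iff)
  moreover obtain B where "B \<in> independent_sets (trung H v)" "card B = independence_number (trung H v)"
    by (rule obtain_maximum_independent[OF finG])
  ultimately show ?thesis using le by force
qed

section \<open>Regular sequences and polynomial relations\<close>

context cring
begin

lemma mem_Idl_insert:
  assumes J: "ideal J R" and y: "y \<in> carrier R"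
  shows "z \<in> Idl (insert y J) \<longleftrightarrow> (\<exists>j\<in>J. \<exists>c\<in>carrier R. z = j \<oplus> c \<otimes> y)"
proof
  have Jc: "J \<subseteq> carrier R" using ideal.Icarr[OF J] by blast
  have "ideal (J <+> PIdl y) R" by (rule add_ideals[OF J cgenideal_ideal[OF y]])
  moreover have "insert y J \<subseteq> J <+> PIdl y"
  proof (intro insert_subsetI subsetI)
    have "y = \<zero> \<oplus> \<one> \<otimes> y" using y by simp
    then show "y \<in> J <+> PIdl y"
      unfolding set_add_def' cgenideal_def
      using additive_subgroup.zero_closed[OF ideal.axioms(1)[OF J]] by blast
  next
    fix j assume "j \<in> J"
    moreover have "j = j \<oplus> \<zero> \<otimes> y" using \<open>j \<in> J\<close> Jc y by auto
    ultimately show "j \<in> J <+> PIdl y" unfolding set_add_def' cgenideal_def by blast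
  qed
  ultimately have "Idl (insert y J) \<subseteq> J <+> PIdl y" by (rule genideal_minimal)
  then show "z \<in> Idl (insert y J) \<Longrightarrow> \<exists>j\<in>J. \<exists>c\<in>carrier R. z = j \<oplus> c \<otimes> y"
    unfolding set_add_def' cgenideal_def by blast
next
  have sub: "insert y J \<subseteq> carrier R" using ideal.Icarr[OF J] y by blast
  note I = genideal_ideal[OF sub] and self = genideal_self[OF sub]
  assume "\<exists>j\<in>J. \<exists>c\<in>carrier R. z = j \<oplus> c \<otimes> y"
  then show "z \<in> Idl (insert y J)"
    using self ideal.I_l_closed[OF I] additive_subgroup.a_closed[OF ideal.axioms(1)[OF I]] by blast
qed

lemma ideal_Idl_insert: "ideal J R \<Longrightarrow> y \<in> carrier R \<Longrightarrow> ideal (Idl (insert y J)) R"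
  by (rule genideal_ideal) (auto dest: ideal.Icarr)

lemma subset_Idl_insert: "ideal J R \<Longrightarrow> y \<in> carrier R \<Longrightarrow> insert y J \<subseteq> Idl (insert y J)"
  by (rule genideal_self) (auto dest: ideal.Icarr)

lemma Idl_insert_Idl:
  assumes X: "X \<subseteq> carrier R" and y: "y \<in> carrier R"
  shows "Idl (insert y (Idl X)) = Idl (insert y X)"
proof
  have yX: "insert y X \<subseteq> carrier R" using X y by blast
  have "Idl X \<subseteq> Idl (insert y X)"
    using genideal_minimal[OF genideal_ideal[OF yX]] genideal_self[OF yX] by blast
  then show "Idl (insert y (Idl X)) \<subseteq> Idl (insert y X)"
    using genideal_minimal[OF genideal_ideal[OF yX]] genideal_self[OF yX] by blast
  have "insert y (Idl X) \<subseteq> Idl (insert y (Idl X))"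
    by (rule subset_Idl_insert[OF genideal_ideal[OF X] y])
  then show "Idl (insert y X) \<subseteq> Idl (insert y (Idl X))"
    using genideal_minimal[OF ideal_Idl_insert[OF genideal_ideal[OF X] y]] genideal_self[OF X] by blast
qed

text \<open>
  The element \<open>b\<close> stands for a relation that annihilates \<open>f\<close> modulo \<open>J\<close>; the lemma carries it over to the
  next ideal \<open>J + (y)\<close> of a regular sequence. If every \<open>g\<close> with \<open>b g \<in> J\<close> lay in \<open>J + (y)\<close>, then each
  such \<open>g\<close> would be \<open>j + g' y\<close> with \<open>b g' \<in> J\<close> again, because \<open>y\<close> is a nonzerodivisor modulo \<open>J\<close>.
  The ideals \<open>J + (g)\<close> would thus increase; at a maximal one \<open>g' \<in> J + (g)\<close>, hence
  \<open>(1 - c y) g' \<in> J\<close> for some \<open>c\<close>. As \<open>y\<close> lies in the Jacobson radical, \<open>1 - c y\<close> is a unit, and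
  \<open>g' \<in> J\<close>, which forces \<open>g \<in> J\<close>. This is Nakayama's lemma, inlined.
\<close>

lemma obtain_annihilated_outside:
  assumes noeth: "noetherian_ring R" and J: "ideal J R" and y: "y \<in> carrier R"
    and nzd: "\<And>z. z \<in> carrier R \<Longrightarrow> y \<otimes> z \<in> J \<Longrightarrow> z \<in> J"
    and rad: "\<And>c. c \<in> carrier R \<Longrightarrow> \<one> \<ominus> c \<otimes> y \<in> Units R"
    and f: "f \<in> carrier R" "f \<notin> J" and b: "b \<in> carrier R" "b \<otimes> f \<in> J"
  obtains g where "g \<in> carrier R" and "g \<notin> Idl (insert y J)" and "b \<otimes> g \<in> J"
proof (rule ccontr)
  assume "\<not> thesis"
  then have sub: "g \<in> Idl (insert y J)" if "g \<in> carrier R" "b \<otimes> g \<in> J" for g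
    using that \<open>(\<And>g. \<lbrakk>g \<in> carrier R; g \<notin> Idl (insert y J); b \<otimes> g \<in> J\<rbrakk> \<Longrightarrow> thesis)\<close> by blast
  interpret J: ideal J R by (rule J)
  define N where "N = {g \<in> carrier R. b \<otimes> g \<in> J \<and> g \<notin> J}"
  define F where "F = (\<lambda>g. Idl (insert g J)) ` N"
  have "F \<noteq> {}" using f b by (auto simp: F_def N_def)
  moreover have "\<Union>C \<in> F" if "C \<noteq> {}" "subset.chain F C" for C
  proof -
    have "F \<subseteq> {I. ideal I R}" using ideal_Idl_insert[OF J] by (auto simp: F_def N_def)
    then have "subset.chain {I. ideal I R} C" using that(2) by (auto simp: subset_chain_def)
    then have "\<Union>C \<in> C" by (rule noetherian_ring.ideal_chain_is_trivial[OF noeth that(1)])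
    then show ?thesis using that(2) by (auto simp: subset_chain_def)
  qed
  ultimately obtain M where M: "M \<in> F" "\<And>X. X \<in> F \<Longrightarrow> M \<subseteq> X \<Longrightarrow> X = M"
    using subset_Zorn_nonempty[of F] by metis
  then obtain g where g: "g \<in> carrier R" "b \<otimes> g \<in> J" "g \<notin> J" "M = Idl (insert g J)"
    by (auto simp: F_def N_def)
  obtain j g' where j: "j \<in> J" and g': "g' \<in> carrier R" and eq: "g = j \<oplus> g' \<otimes> y"
    using sub[OF g(1,2)] mem_Idl_insert[OF J y] by blast
  have jc: "j \<in> carrier R" using j by (rule J.Icarr)
  have "y \<otimes> (b \<otimes> g') = b \<otimes> g \<ominus> b \<otimes> j"
    unfolding eq using y b(1) g' jc by algebra
  moreover have "b \<otimes> g \<ominus> b \<otimes> j \<in> J"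
    unfolding a_minus_def using g(2) j b(1) by (simp add: J.I_l_closed J.a_closed J.a_inv_closed)
  ultimately have bg': "b \<otimes> g' \<in> J" using nzd[of "b \<otimes> g'"] b(1) g' by simp
  have "g' \<notin> J"
  proof
    assume "g' \<in> J"
    then have "g \<in> J" unfolding eq using j y by (simp add: J.I_r_closed J.a_closed)
    then show False using g(3) by simp
  qed
  then have "Idl (insert g' J) \<in> F" using g' bg' by (auto simp: F_def N_def)
  moreover have "M \<subseteq> Idl (insert g' J)"
  proof -
    have "g = j \<oplus> y \<otimes> g'" using eq m_comm[OF g' y] by simp
    then have "g \<in> Idl (insert g' J)" using mem_Idl_insert[OF J g'] j y by blast
    then show ?thesis
      unfolding g(4) using subset_Idl_insert[OF J g']
      by (intro genideal_minimal[OF ideal_Idl_insert[OF J g']]) blast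
  qed
  ultimately have "Idl (insert g' J) = Idl (insert g J)" using M(2) g(4) by blast
  then have "g' \<in> Idl (insert g J)" using subset_Idl_insert[OF J g'] by blast
  then obtain i c where i: "i \<in> J" and c: "c \<in> carrier R" and eq': "g' = i \<oplus> c \<otimes> g"
    using mem_Idl_insert[OF J g(1)] by blast
  have ic: "i \<in> carrier R" using i by (rule J.Icarr)
  have "(\<one> \<ominus> c \<otimes> y) \<otimes> g' = i \<oplus> c \<otimes> j"
  proof -
    have "(\<one> \<ominus> c \<otimes> y) \<otimes> g' = g' \<ominus> c \<otimes> (g' \<otimes> y)" using c y g' by algebra
    also have "g' \<otimes> y = g \<ominus> j" unfolding eq using jc g' y by algebra
    also have "g' \<ominus> c \<otimes> (g \<ominus> j) = i \<oplus> c \<otimes> j"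
      by (subst eq') (use ic c g(1) jc in algebra)
    finally show ?thesis .
  qed
  then have "(\<one> \<ominus> c \<otimes> y) \<otimes> g' \<in> J" using i j c by (simp add: J.I_l_closed J.a_closed)
  then have "inv (\<one> \<ominus> c \<otimes> y) \<otimes> ((\<one> \<ominus> c \<otimes> y) \<otimes> g') \<in> J"
    using rad[OF c] by (simp add: J.I_l_closed)
  moreover have "inv (\<one> \<ominus> c \<otimes> y) \<otimes> ((\<one> \<ominus> c \<otimes> y) \<otimes> g') = g'"
    using rad[OF c] g' by (simp add: m_assoc[symmetric] Units_closed)
  ultimately show False using \<open>g' \<notin> J\<close> by simp
qed

end

text \<open>
  Regularity on the quotient by an arbitrary ideal, in recursive form: the induction below passes from
  \<open>J\<close> to \<open>J + (y)\<close>, which the formulation by initial segments does not allow directly. Properness of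
  the ideals is replaced by carrying along an element outside \<open>J\<close>.
\<close>

primrec regular_modulo :: "('a, 'b) ring_scheme \<Rightarrow> 'a set \<Rightarrow> 'a list \<Rightarrow> bool" where
  "regular_modulo R J [] \<longleftrightarrow> True"
| "regular_modulo R J (y # ys) \<longleftrightarrow>
     (\<forall>z\<in>carrier R. y \<otimes>\<^bsub>R\<^esub> z \<in> J \<longrightarrow> z \<in> J) \<and> regular_modulo R (Idl\<^bsub>R\<^esub> (insert y J)) ys"

text \<open>
  The monomial \<open>y\<^sub>1\<^bsup>e\<^sub>1\<^esup> \<cdots> y\<^sub>r\<^bsup>e\<^sub>r\<^esup>\<close>. Exponent vectors are lists and are meant to have the length of
  \<open>ys\<close>; the recursion takes them apart by \<open>hd\<close> and \<open>tl\<close> so that it follows \<open>ys\<close> alone.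
\<close>

primrec power_product :: "('a, 'b) ring_scheme \<Rightarrow> 'a list \<Rightarrow> nat list \<Rightarrow> 'a" where
  "power_product R [] e = \<one>\<^bsub>R\<^esub>"
| "power_product R (y # ys) e = y [^]\<^bsub>R\<^esub> hd e \<otimes>\<^bsub>R\<^esub> power_product R ys (tl e)"

context cring
begin

lemma power_product_closed: "set ys \<subseteq> carrier R \<Longrightarrow> power_product R ys e \<in> carrier R"
  by (induction ys arbitrary: e) auto

lemma regular_modulo_of_regular_sequence:
  assumes "regular_sequence R (pre @ ys)"
  shows "regular_modulo R (Idl (set pre)) ys"
  using assms
proof (induction ys arbitrary: pre)
  case (Cons y ys)
  have sub: "set pre \<subseteq> carrier R" "y \<in> carrier R" using Cons.prems by (auto simp: regular_sequence_def)
  have "\<forall>z\<in>carrier R. y \<otimes> z \<in> Idl (set pre) \<longrightarrow> z \<in> Idl (set pre)"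
    using Cons.prems unfolding regular_sequence_def
    by (auto dest!: spec[of _ "length pre"])
  moreover have "regular_modulo R (Idl (set (pre @ [y]))) ys"
    using Cons.prems by (intro Cons.IH) simp
  moreover have "set (pre @ [y]) = insert y (set pre)" by auto
  ultimately show ?case using Idl_insert_Idl[OF sub] by simp
qed simp

lemma power_nonzerodivisor:
  assumes y: "y \<in> carrier R" and nzd: "\<And>z. z \<in> carrier R \<Longrightarrow> y \<otimes> z \<in> J \<Longrightarrow> z \<in> J"
    and "z \<in> carrier R" and "y [^] (m::nat) \<otimes> z \<in> J"
  shows "z \<in> J"
  using assms(4)
proof (induction m)
  case 0
  then show ?case using assms by simp
next
  case (Suc m)
  have "y \<otimes> (y [^] m \<otimes> z) \<in> J" using Suc.prems y \<open>z \<in> carrier R\<close>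
    by (simp add: m_assoc[symmetric] m_comm)
  then show ?case using nzd[of "y [^] m \<otimes> z"] Suc.IH y \<open>z \<in> carrier R\<close> by simp
qed

lemma finsum_in_ideal:
  assumes "ideal J R" and "finite E" and "\<And>e. e \<in> E \<Longrightarrow> h e \<in> J"
  shows "(\<Oplus>e\<in>E. h e) \<in> J"
  using assms(2,3)
proof (induction E rule: finite_induct)
  case empty
  then show ?case using additive_subgroup.zero_closed[OF ideal.axioms(1)[OF assms(1)]] by simp
next
  case (insert e E)
  have "(\<Oplus>e\<in>insert e E. h e) = h e \<oplus> (\<Oplus>e\<in>E. h e)"
    using insert by (intro finsum_insert) (auto intro: ideal.Icarr[OF assms(1)])
  then show ?case using insert additive_subgroup.a_closed[OF ideal.axioms(1)[OF assms(1)]] by simp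
qed

text \<open>
  Elements of the Jacobson radical that form a regular sequence satisfy no polynomial relation with
  unit coefficients, not even after multiplication by some \<open>f \<notin> J\<close>. Let \<open>m\<close> be the least exponent of the
  first element \<open>y\<close> that occurs. As \<open>y\<close> is a nonzerodivisor, the factor \<open>y\<^sup>m\<close> may be cancelled, leaving a
  relation \<open>B\<close> with \<open>B f \<in> J\<close>. Replace \<open>f\<close> by some \<open>g \<notin> J + (y)\<close> with \<open>B g \<in> J\<close>. Modulo \<open>J + (y)\<close> only
  the terms of \<open>B\<close> without \<open>y\<close> survive; by the choice of \<open>m\<close> there are some, and they form a relation
  between the remaining elements.
\<close>

theorem regular_modulo_independent:
  assumes noeth: "noetherian_ring R"
    and "regular_modulo R J ys" and "ideal J R" and "set ys \<subseteq> carrier R"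
    and "\<And>y c. y \<in> set ys \<Longrightarrow> c \<in> carrier R \<Longrightarrow> \<one> \<ominus> c \<otimes> y \<in> Units R"
    and "f \<in> carrier R" and "f \<notin> J"
    and "finite E" and "E \<noteq> {}" and "\<And>e. e \<in> E \<Longrightarrow> length e = length ys"
    and "\<And>e. e \<in> E \<Longrightarrow> c e \<in> Units R"
  shows "(\<Oplus>e\<in>E. c e \<otimes> power_product R ys e) \<otimes> f \<notin> J"
  using assms(2-)
proof (induction ys arbitrary: J f E c)
  case Nil
  interpret J: ideal J R by (rule Nil.prems(2))
  have E: "E = {[]}" using Nil.prems by auto
  then have u: "c [] \<in> Units R" using Nil.prems by simp
  have "f = inv (c []) \<otimes> (c [] \<otimes> f)"
    using u Nil.prems by (simp add: m_assoc[symmetric] Units_closed)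
  then have "c [] \<otimes> f \<notin> J"
    using u Nil.prems J.I_l_closed by (metis Units_inv_closed)
  then show ?case using u by (simp add: E Units_closed)
next
  case (Cons y ys)
  interpret J: ideal J R by (rule Cons.prems(2))
  let ?J = "Idl (insert y J)"
  have y: "y \<in> carrier R" and ys: "set ys \<subseteq> carrier R" using Cons.prems(3) by auto
  have nzd: "\<And>z. z \<in> carrier R \<Longrightarrow> y \<otimes> z \<in> J \<Longrightarrow> z \<in> J" using Cons.prems(1) by simp
  interpret J': ideal ?J R by (rule ideal_Idl_insert[OF Cons.prems(2) y])
  have yJ': "insert y J \<subseteq> ?J" by (rule subset_Idl_insert[OF Cons.prems(2) y])
  have cE: "c e \<in> carrier R" if "e \<in> E" for e using Cons.prems(10)[OF that] by (rule Units_closed)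
  note pc = power_product_closed[OF ys]
  define m where "m = Min (hd ` E)"
  have m_le: "m \<le> hd e" if "e \<in> E" for e using that Cons.prems(7) by (simp add: m_def)
  have "m \<in> hd ` E" unfolding m_def using Cons.prems(7,8) by (intro Min_in) auto
  define t where "t = (\<lambda>e. c e \<otimes> (y [^] (hd e - m) \<otimes> power_product R ys (tl e)))"
  have t: "t e \<in> carrier R" if "e \<in> E" for e unfolding t_def using cE[OF that] pc y by simp
  define B where "B = (\<Oplus>e\<in>E. t e)"
  have B: "B \<in> carrier R" unfolding B_def using t by (intro finsum_closed) auto
  show ?case
  proof
    assume *: "(\<Oplus>e\<in>E. c e \<otimes> power_product R (y # ys) e) \<otimes> f \<in> J"
    have "c e \<otimes> power_product R (y # ys) e = y [^] m \<otimes> t e" if "e \<in> E" for e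
    proof -
      have "y [^] hd e = y [^] m \<otimes> y [^] (hd e - m)" using m_le[OF that] y by (simp add: nat_pow_mult)
      then show ?thesis
        unfolding t_def using cE[OF that] pc[of "tl e"] y by (simp add: m_ac)
    qed
    then have "(\<Oplus>e\<in>E. c e \<otimes> power_product R (y # ys) e) = (\<Oplus>e\<in>E. y [^] m \<otimes> t e)"
      using t y by (intro finsum_cong) (auto simp: simp_implies_def)
    also have "\<dots> = y [^] m \<otimes> B"
      unfolding B_def using t y Cons.prems(7) by (intro finsum_rdistr[symmetric]) auto
    finally have "y [^] m \<otimes> (B \<otimes> f) \<in> J" using * B y Cons.prems(5) by (simp add: m_assoc)
    then have "B \<otimes> f \<in> J" using power_nonzerodivisor[OF y nzd m_closed[OF B Cons.prems(5)]] by blast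
    then obtain g where g: "g \<in> carrier R" "g \<notin> ?J" "B \<otimes> g \<in> J"
      using obtain_annihilated_outside[OF noeth Cons.prems(2) y nzd _ Cons.prems(5,6) B] Cons.prems(4)
      by (metis list.set_intros(1))
    \<comment> \<open>the terms of \<open>B\<close> free of \<open>y\<close> and, in \<open>B2\<close>, those divisible by \<open>y\<close>\<close>
    define E1 where "E1 = {e \<in> E. hd e = m}"
    define B1 where "B1 = (\<Oplus>e\<in>E1. t e)"
    define B2 where "B2 = (\<Oplus>e\<in>E - E1. t e)"
    have B1: "B1 \<in> carrier R" and B2: "B2 \<in> carrier R"
      unfolding B1_def B2_def using t by (auto intro!: finsum_closed simp: E1_def)
    have "B = (\<Oplus>e\<in>E1 \<union> (E - E1). t e)" unfolding B_def by (rule arg_cong2[where f = "finsum R"]) (auto simp: E1_def)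
    also have "\<dots> = B1 \<oplus> B2" unfolding B1_def B2_def
      using t Cons.prems(7) by (intro finsum_Un_disjoint) (auto simp: E1_def)
    finally have BB: "B = B1 \<oplus> B2" .
    have "B2 \<in> ?J" unfolding B2_def
    proof (rule finsum_in_ideal[OF J'.is_ideal])
      show "finite (E - E1)" using Cons.prems(7) by simp
      fix e assume e: "e \<in> E - E1"
      then have "hd e - m = Suc (hd e - m - 1)" using m_le[of e] by (auto simp: E1_def)
      then obtain k where k: "hd e - m = Suc k" by blast
      have "t e = (c e \<otimes> (y [^] k \<otimes> power_product R ys (tl e))) \<otimes> y"
        unfolding t_def k using cE[of e] e pc[of "tl e"] y by (simp add: m_ac)
      then show "t e \<in> ?J"
        using yJ' J'.I_l_closed[of y "c e \<otimes> (y [^] k \<otimes> power_product R ys (tl e))"] cE[of e] e pc[of "tl e"] y by simp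
    qed
    have "B1 \<otimes> g = B \<otimes> g \<ominus> B2 \<otimes> g" unfolding BB using B1 B2 g(1) by algebra
    moreover have "B \<otimes> g \<in> ?J" using g(3) yJ' by blast
    moreover have "B2 \<otimes> g \<in> ?J" using \<open>B2 \<in> ?J\<close> g(1) by (rule J'.I_r_closed)
    ultimately have in_J': "B1 \<otimes> g \<in> ?J"
      unfolding a_minus_def by (simp add: J'.a_closed J'.a_inv_closed)
    have len: "e = m # tl e" if "e \<in> E1" for e
      using that Cons.prems(9)[of e] by (cases e) (auto simp: E1_def)
    \<comment> \<open>dropping the common first exponent keeps the exponent vectors distinct, so no terms cancel\<close>
    have inj: "inj_on tl E1" by (rule inj_onI) (metis len)
    define E' where "E' = tl ` E1"
    have E1E: "m # e \<in> E" if "e \<in> E'" for e using that len by (auto simp: E'_def E1_def)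
    have "B1 = (\<Oplus>e\<in>E1. c (m # tl e) \<otimes> power_product R ys (tl e))"
      unfolding B1_def
    proof (rule finsum_cong')
      fix e assume e: "e \<in> E1"
      then have "hd e = m" "m # tl e = e" using len[of e] by (auto simp: E1_def)
      then show "t e = c (m # tl e) \<otimes> power_product R ys (tl e)"
        unfolding t_def using pc by simp
    qed (use cE pc E1E in \<open>auto simp: E'_def\<close>)
    also have "\<dots> = (\<Oplus>e\<in>E'. c (m # e) \<otimes> power_product R ys e)"
      unfolding E'_def using E1E cE pc inj by (intro finsum_reindex[symmetric]) (auto simp: E'_def)
    finally have "(\<Oplus>e\<in>E'. c (m # e) \<otimes> power_product R ys e) \<otimes> g \<in> ?J" using in_J' by simp
    moreover have "(\<Oplus>e\<in>E'. c (m # e) \<otimes> power_product R ys e) \<otimes> g \<notin> ?J"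
    proof (rule Cons.IH)
      show "regular_modulo R ?J ys" using Cons.prems(1) by simp
      show "ideal ?J R" by (rule J'.is_ideal)
      show "set ys \<subseteq> carrier R" by (rule ys)
      show "\<one> \<ominus> a \<otimes> z \<in> Units R" if "z \<in> set ys" "a \<in> carrier R" for z a
        using Cons.prems(4)[of z a] that by simp
      show "g \<in> carrier R" "g \<notin> ?J" by fact+
      show "finite E'" using Cons.prems(7) by (simp add: E'_def E1_def)
      show "E' \<noteq> {}" using \<open>m \<in> hd ` E\<close> by (auto simp: E'_def E1_def)
      show "length e = length ys" if "e \<in> E'" for e using Cons.prems(9)[OF E1E[OF that]] by simp
      show "c (m # e) \<in> Units R" if "e \<in> E'" for e using Cons.prems(10)[OF E1E[OF that]] .
    qed
    ultimately show False by simp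
  qed
qed

end

context cring
begin

lemma power_product_mult:
  assumes "\<And>y. y \<in> set ys \<Longrightarrow> u y \<in> carrier R" and "set ys \<subseteq> carrier R"
  shows "power_product R (map (\<lambda>y. u y \<otimes> y) ys) e = power_product R (map u ys) e \<otimes> power_product R ys e"
  using assms
proof (induction ys arbitrary: e)
  case (Cons y ys)
  have "power_product R (map u ys) (tl e) \<in> carrier R" "power_product R ys (tl e) \<in> carrier R"
    using Cons.prems by (auto intro!: power_product_closed)
  then show ?case using Cons by (simp add: nat_pow_distrib m_ac)
qed simp

lemma power_product_Units:
  "set us \<subseteq> Units R \<Longrightarrow> power_product R us e \<in> Units R"
  by (induction us arbitrary: e) (auto intro!: Units_m_closed Units_pow_closed)

end

lemma (in ring_hom_cring) power_product_hom:
  assumes "set qs \<subseteq> carrier R"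
  shows "h (power_product R qs e) = power_product S (map h qs) e"
  using assms
proof (induction qs arbitrary: e)
  case (Cons p qs)
  have "power_product R qs (tl e) \<in> carrier R" using Cons.prems by (auto intro!: R.power_product_closed)
  then show ?case using Cons by (simp add: ring.hom_nat_pow)
qed simp

section \<open>Primes generated by variables, and the edge ideal\<close>

abbreviation supp :: "('a \<Rightarrow>\<^sub>0 'b::zero) \<Rightarrow> 'a set" where
  "supp \<equiv> Poly_Mapping.keys"

abbreviation lookup :: "('a \<Rightarrow>\<^sub>0 'b::zero) \<Rightarrow> 'a \<Rightarrow> 'b" where
  "lookup \<equiv> Poly_Mapping.lookup"

lemma carrier_polynomial_ring:
  "p \<in> carrier (polynomial_ring V) \<longleftrightarrow> (\<forall>m\<in>supp p. supp m \<subseteq> V)"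
  by (simp add: polynomial_ring_def)

lemma polynomial_ring_simps [simp]:
  "x \<otimes>\<^bsub>polynomial_ring V\<^esub> y = x * y" "\<one>\<^bsub>polynomial_ring V\<^esub> = 1"
  "x \<oplus>\<^bsub>polynomial_ring V\<^esub> y = x + y" "\<zero>\<^bsub>polynomial_ring V\<^esub> = 0"
  by (simp_all add: polynomial_ring_def)

lemma keys_add_nat: "supp (m + n :: 'a \<Rightarrow>\<^sub>0 nat) = supp m \<union> supp n"
  by (auto simp: in_keys_iff lookup_add)

lemma keys_multE:
  assumes "m \<in> supp (p * q)"
  obtains k n where "k \<in> supp p" "n \<in> supp q" "m = k + n"
  using assms keys_mult[of p q] by blast

lemma keys_uminus: "supp (- p :: 'a \<Rightarrow>\<^sub>0 'b::ab_group_add) = supp p"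
  by (auto simp: in_keys_iff)

lemma single_carrier: "supp m \<subseteq> V \<Longrightarrow> Poly_Mapping.single m c \<in> carrier (polynomial_ring V)"
  by (simp add: carrier_polynomial_ring)

lemma cring_polynomial_ring: "cring (polynomial_ring V :: (('a \<Rightarrow>\<^sub>0 nat) \<Rightarrow>\<^sub>0 'k::field) ring)"
proof (rule cringI)
  show "abelian_group (polynomial_ring V :: (('a \<Rightarrow>\<^sub>0 nat) \<Rightarrow>\<^sub>0 'k) ring)"
  proof (rule abelian_groupI)
    fix x y :: "('a \<Rightarrow>\<^sub>0 nat) \<Rightarrow>\<^sub>0 'k"
    assume x: "x \<in> carrier (polynomial_ring V)" and "y \<in> carrier (polynomial_ring V)"
    then show "x \<oplus>\<^bsub>polynomial_ring V\<^esub> y \<in> carrier (polynomial_ring V)"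
      using keys_add[of x y] by (auto simp: carrier_polynomial_ring)
    have "- x \<in> carrier (polynomial_ring V)" using x by (simp add: carrier_polynomial_ring keys_uminus)
    moreover have "- x \<oplus>\<^bsub>polynomial_ring V\<^esub> x = \<zero>\<^bsub>polynomial_ring V\<^esub>" by simp
    ultimately show "\<exists>z\<in>carrier (polynomial_ring V). z \<oplus>\<^bsub>polynomial_ring V\<^esub> x = \<zero>\<^bsub>polynomial_ring V\<^esub>"
      by blast
  qed (auto simp: carrier_polynomial_ring add_ac)
  show "comm_monoid (polynomial_ring V :: (('a \<Rightarrow>\<^sub>0 nat) \<Rightarrow>\<^sub>0 'k) ring)"
  proof (rule comm_monoidI)
    fix x y :: "('a \<Rightarrow>\<^sub>0 nat) \<Rightarrow>\<^sub>0 'k"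
    assume "x \<in> carrier (polynomial_ring V)" and "y \<in> carrier (polynomial_ring V)"
    then show "x \<otimes>\<^bsub>polynomial_ring V\<^esub> y \<in> carrier (polynomial_ring V)"
      by (fastforce simp: carrier_polynomial_ring keys_add_nat elim!: keys_multE)
  qed (auto simp: carrier_polynomial_ring mult_ac)
qed (simp add: distrib_right)

lemma a_inv_polynomial_ring:
  assumes "p \<in> carrier (polynomial_ring V)"
  shows "\<ominus>\<^bsub>polynomial_ring V\<^esub> p = - p"
proof -
  interpret cring "polynomial_ring V :: (('a \<Rightarrow>\<^sub>0 nat) \<Rightarrow>\<^sub>0 'b) ring" by (rule cring_polynomial_ring)
  have "- p \<in> carrier (polynomial_ring V)" using assms by (simp add: carrier_polynomial_ring keys_uminus)
  then show ?thesis using assms minus_equality[of "- p" p] by simp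
qed

text \<open>
  The ideal generated by the variables outside \<open>B\<close>: its members are the polynomials that vanish when
  these variables are set to zero. For \<open>B = {}\<close> it consists of the polynomials without constant term.
\<close>

definition coordinate_prime :: "'a set \<Rightarrow> 'a set \<Rightarrow> (('a \<Rightarrow>\<^sub>0 nat) \<Rightarrow>\<^sub>0 'k::field) set" where
  "coordinate_prime V B = {p \<in> carrier (polynomial_ring V). \<forall>m\<in>supp p. \<not> supp m \<subseteq> B}"

text \<open>
  A numbering \<open>g\<close> of \<open>B\<close> transports the monomials in the variables \<open>B\<close> to exponent functions on the
  naturals, which carry a linear order compatible with addition. This makes leading monomials available
  although the vertices themselves are not ordered.
\<close>

definition order_code :: "('a \<Rightarrow> nat) \<Rightarrow> 'a set \<Rightarrow> ('a \<Rightarrow>\<^sub>0 nat) \<Rightarrow> (nat \<Rightarrow>\<^sub>0 nat)" where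
  "order_code g B m = (\<Sum>u\<in>B. Poly_Mapping.single (g u) (lookup m u))"

lemma order_code_add: "order_code g B (m + n) = order_code g B m + order_code g B n"
  by (simp add: order_code_def lookup_add single_add sum.distrib)

lemma order_code_inject:
  assumes "finite B" "inj_on g B" "supp m \<subseteq> B" "supp n \<subseteq> B" "order_code g B m = order_code g B n"
  shows "m = n"
proof (rule poly_mapping_eqI)
  fix u
  have lo: "lookup (order_code g B k) (g u) = lookup k u" if "u \<in> B" for k
  proof -
    have "lookup (order_code g B k) (g u) = (\<Sum>w\<in>B. if w = u then lookup k u else 0)"
      unfolding order_code_def lookup_sum
      using that assms(2) by (intro sum.cong) (auto simp: lookup_single when_def dest: inj_onD)
    then show ?thesis using that assms(1) by simp
  qed
  show "lookup m u = lookup n u"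
  proof (cases "u \<in> B")
    case True
    then show ?thesis using lo[of m] lo[of n] assms(5) by simp
  next
    case False
    then have "u \<notin> supp m" "u \<notin> supp n" using assms(3,4) by auto
    then show ?thesis by (simp add: in_keys_iff)
  qed
qed

text \<open>
  Among the monomials supported in \<open>B\<close>, let \<open>mp\<close> and \<open>mq\<close> be the leading ones of \<open>p\<close> and \<open>q\<close>. A pair
  of monomials of \<open>p\<close> and \<open>q\<close> with product \<open>mp + mq\<close> is itself supported in \<open>B\<close>, hence equal to
  \<open>(mp, mq)\<close>, so the coefficient of \<open>mp + mq\<close> in \<open>p q\<close> is a product of nonzero coefficients.
\<close>

lemma mult_supported:
  fixes p q :: "('a \<Rightarrow>\<^sub>0 nat) \<Rightarrow>\<^sub>0 'k::field"
  assumes B: "finite B"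
    and p: "\<exists>m\<in>supp p. supp m \<subseteq> B" and q: "\<exists>m\<in>supp q. supp m \<subseteq> B"
  shows "\<exists>m\<in>supp (p * q). supp m \<subseteq> B"
proof -
  obtain g :: "'a \<Rightarrow> nat" where g: "inj_on g B" using finite_imp_inj_to_nat_seg[OF B] by blast
  let ?W = "order_code g B"
  have lead: "\<exists>m\<in>supp r. supp m \<subseteq> B \<and> (\<forall>n\<in>supp r. supp n \<subseteq> B \<longrightarrow> ?W n \<le> ?W m)"
    if "\<exists>m\<in>supp r. supp m \<subseteq> B" for r :: "('a \<Rightarrow>\<^sub>0 nat) \<Rightarrow>\<^sub>0 'k"
  proof -
    let ?S = "{m \<in> supp r. supp m \<subseteq> B}"
    have S: "finite (?W ` ?S)" "?W ` ?S \<noteq> {}" using that by auto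
    obtain m where m: "Max (?W ` ?S) = ?W m" "m \<in> ?S" using Max_in[OF S] by (rule imageE)
    have "?W n \<le> ?W m" if "n \<in> supp r" "supp n \<subseteq> B" for n
      using Max_ge[OF S(1), of "?W n"] that unfolding m(1) by blast
    then show ?thesis using m(2) by blast
  qed
  obtain mp where mp: "mp \<in> supp p" "supp mp \<subseteq> B" "\<And>n. n \<in> supp p \<Longrightarrow> supp n \<subseteq> B \<Longrightarrow> ?W n \<le> ?W mp"
    using lead[OF p] by blast
  obtain mq where mq: "mq \<in> supp q" "supp mq \<subseteq> B" "\<And>n. n \<in> supp q \<Longrightarrow> supp n \<subseteq> B \<Longrightarrow> ?W n \<le> ?W mq"
    using lead[OF q] by blast
  let ?a = "lookup p mp" and ?b = "lookup q mq"
  define p' where "p' = p - Poly_Mapping.single mp ?a"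
  define q' where "q' = q - Poly_Mapping.single mq ?b"
  have p': "k \<in> supp p \<and> k \<noteq> mp" if "k \<in> supp p'" for k
    using that by (auto simp: p'_def in_keys_iff lookup_minus lookup_single when_def split: if_splits)
  have q': "k \<in> supp q \<and> k \<noteq> mq" if "k \<in> supp q'" for k
    using that by (auto simp: q'_def in_keys_iff lookup_minus lookup_single when_def split: if_splits)
  have "mp + mq \<notin> supp (Poly_Mapping.single mp ?a * q')"
  proof -
    have "mq \<notin> supp q'" using q' by blast
    then show ?thesis by (auto elim!: keys_multE split: if_splits)
  qed
  moreover have "mp + mq \<notin> supp (p' * q)"
  proof
    assume "mp + mq \<in> supp (p' * q)"
    then obtain k n where kn: "k \<in> supp p'" "n \<in> supp q" "mp + mq = k + n" by (rule keys_multE)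
    have "supp k \<union> supp n \<subseteq> B" using mp(2) mq(2) kn(3) by (metis keys_add_nat Un_subset_iff)
    then have le: "?W k \<le> ?W mp" "?W n \<le> ?W mq" using mp(3)[of k] mq(3)[of n] kn p' by auto
    have "?W mp + ?W mq = ?W k + ?W n" using kn(3) by (metis order_code_add)
    then have "?W k = ?W mp"
      using le by (metis add_le_cancel_right add_left_mono order_antisym)
    then have "k = mp" using \<open>supp k \<union> supp n \<subseteq> B\<close> mp(2) by (intro order_code_inject[OF B g]) auto
    then show False using p'[OF kn(1)] by simp
  qed
  moreover have "p * q = Poly_Mapping.single (mp + mq) (?a * ?b) + Poly_Mapping.single mp ?a * q' + p' * q"
    unfolding p'_def q'_def mult_single[symmetric] by (simp add: algebra_simps)
  ultimately have "lookup (p * q) (mp + mq) = ?a * ?b"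
    by (simp add: lookup_add in_keys_iff)
  also have "\<dots> \<noteq> 0" using mp(1) mq(1) by (simp add: in_keys_iff)
  finally have "mp + mq \<in> supp (p * q)" by (simp add: in_keys_iff)
  then show ?thesis using mp(2) mq(2) by (intro bexI[of _ "mp + mq"]) (auto simp: keys_add_nat)
qed

lemma coordinate_prime_primeideal:
  assumes B: "finite B"
  shows "primeideal (coordinate_prime V B) (polynomial_ring V :: (('a \<Rightarrow>\<^sub>0 nat) \<Rightarrow>\<^sub>0 'k::field) ring)"
proof -
  interpret S: cring "polynomial_ring V :: (('a \<Rightarrow>\<^sub>0 nat) \<Rightarrow>\<^sub>0 'k) ring" by (rule cring_polynomial_ring)
  let ?S = "polynomial_ring V :: (('a \<Rightarrow>\<^sub>0 nat) \<Rightarrow>\<^sub>0 'k) ring"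
  let ?P = "coordinate_prime V B :: (('a \<Rightarrow>\<^sub>0 nat) \<Rightarrow>\<^sub>0 'k) set"
  have l: "x * a \<in> ?P" if "a \<in> ?P" "x \<in> carrier ?S" for a x
  proof -
    have "x * a \<in> carrier ?S" using S.m_closed[of x a] that by (simp add: coordinate_prime_def)
    then show ?thesis using that
      by (auto simp: coordinate_prime_def keys_add_nat elim!: keys_multE)
  qed
  show ?thesis
  proof (rule primeidealI)
    show "cring ?S" by (rule S.is_cring)
    show "ideal ?P ?S"
    proof (rule idealI)
      show "ring ?S" by (rule S.ring_axioms)
      show "subgroup ?P (add_monoid ?S)"
      proof (rule S.add.subgroupI)
        show "?P \<subseteq> carrier ?S" by (auto simp: coordinate_prime_def)
        have "0 \<in> ?P" using S.zero_closed by (simp add: coordinate_prime_def)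
        then show "?P \<noteq> {}" by blast
        show "\<ominus>\<^bsub>?S\<^esub> a \<in> ?P" if "a \<in> ?P" for a
          using that S.a_inv_closed[of a] by (auto simp: coordinate_prime_def a_inv_polynomial_ring keys_uminus)
        show "a \<oplus>\<^bsub>?S\<^esub> b \<in> ?P" if "a \<in> ?P" "b \<in> ?P" for a b
          using that S.a_closed[of a b] keys_add[of a b] by (auto simp: coordinate_prime_def)
      qed
      show "x \<otimes>\<^bsub>?S\<^esub> a \<in> ?P" if "a \<in> ?P" "x \<in> carrier ?S" for a x using l[OF that] by simp
      show "a \<otimes>\<^bsub>?S\<^esub> x \<in> ?P" if "a \<in> ?P" "x \<in> carrier ?S" for a x
        using l[OF that] by (simp add: mult.commute)
    qed
    have "1 \<in> carrier ?S" "1 \<notin> ?P" using S.one_closed by (simp_all add: coordinate_prime_def)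
    then show "carrier ?S \<noteq> ?P" by metis
    show "a \<in> ?P \<or> b \<in> ?P" if "a \<in> carrier ?S" "b \<in> carrier ?S" "a \<otimes>\<^bsub>?S\<^esub> b \<in> ?P" for a b
      using that mult_supported[OF B, of a b] by (auto simp: coordinate_prime_def)
  qed
qed

lemma coordinate_prime_strict_antimono:
  assumes "B \<subset> C" "C \<subseteq> V"
  shows "(coordinate_prime V C :: (('a \<Rightarrow>\<^sub>0 nat) \<Rightarrow>\<^sub>0 'k::field) set) \<subset> coordinate_prime V B"
proof -
  obtain u where u: "u \<in> C" "u \<notin> B" using assms(1) by blast
  have "var u \<in> (coordinate_prime V B :: (('a \<Rightarrow>\<^sub>0 nat) \<Rightarrow>\<^sub>0 'k) set)"
    "var u \<notin> (coordinate_prime V C :: (('a \<Rightarrow>\<^sub>0 nat) \<Rightarrow>\<^sub>0 'k) set)"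
    using u assms(2) by (auto simp: coordinate_prime_def var_def carrier_polynomial_ring)
  moreover have "coordinate_prime V C \<subseteq> (coordinate_prime V B :: (('a \<Rightarrow>\<^sub>0 nat) \<Rightarrow>\<^sub>0 'k) set)"
    using assms(1) unfolding coordinate_prime_def psubset_eq by (intro Collect_mono) (metis subset_trans)
  ultimately show ?thesis by blast
qed

lemma mem_coordinate_prime_empty:
  "p \<in> coordinate_prime V {} \<longleftrightarrow> p \<in> carrier (polynomial_ring V) \<and> lookup p 0 = 0"
  by (auto simp: coordinate_prime_def in_keys_iff) 

lemma maximalideal_coordinate_prime_empty:
  "maximalideal (coordinate_prime V {}) (polynomial_ring V :: (('a \<Rightarrow>\<^sub>0 nat) \<Rightarrow>\<^sub>0 'k::field) ring)"
proof -
  interpret S: cring "polynomial_ring V :: (('a \<Rightarrow>\<^sub>0 nat) \<Rightarrow>\<^sub>0 'k) ring" by (rule cring_polynomial_ring)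
  let ?S = "polynomial_ring V :: (('a \<Rightarrow>\<^sub>0 nat) \<Rightarrow>\<^sub>0 'k) ring"
  let ?P = "coordinate_prime V {} :: (('a \<Rightarrow>\<^sub>0 nat) \<Rightarrow>\<^sub>0 'k) set"
  interpret P: primeideal ?P ?S by (rule coordinate_prime_primeideal) simp
  show ?thesis
  proof (rule maximalidealI)
    show "ideal ?P ?S" by (rule P.is_ideal)
    show "carrier ?S \<noteq> ?P" by (rule P.I_notcarr)
    fix J assume J: "ideal J ?S" "?P \<subseteq> J" "J \<subseteq> carrier ?S"
    interpret J: ideal J ?S by (rule J(1))
    show "J = ?P \<or> J = carrier ?S"
    proof (cases "J = ?P")
      case False
      then obtain p where p: "p \<in> J" "p \<notin> ?P" using J(2) by blast
      let ?c = "lookup p 0"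
      have pc: "p \<in> carrier ?S" using p J by blast
      then have c: "?c \<noteq> 0" using p by (simp add: mem_coordinate_prime_empty)
      let ?C = "\<lambda>c. Poly_Mapping.single 0 c :: ('a \<Rightarrow>\<^sub>0 nat) \<Rightarrow>\<^sub>0 'k"
      have C: "?C a \<in> carrier ?S" for a by (rule single_carrier) simp
      define r where "r = p + ?C (- ?c)"
      have r: "r \<in> carrier ?S" using pc C[of "- ?c"] S.a_closed[of p "?C (- ?c)"] by (simp add: r_def)
      then have "r \<in> J" using J(2) by (auto simp: r_def mem_coordinate_prime_empty lookup_add)
      then have "- r \<in> J" using J.a_inv_closed[of r] a_inv_polynomial_ring[OF r] by simp
      then have "p + - r \<in> J" using J.a_closed[OF p(1)] by fastforce
      moreover have "p + - r = ?C ?c" by (simp add: r_def single_uminus)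
      ultimately have "?C ?c \<in> J" by simp
      then have "?C (inverse ?c) * ?C ?c \<in> J" using J.I_l_closed[of "?C ?c" "?C (inverse ?c)"] C by simp
      then have "1 \<in> J" using c by (simp add: mult_single)
      then show ?thesis using J.one_imp_carrier by simp
    qed simp
  qed
qed

lemma edge_monomial_carrier:
  assumes G: "pair_graph G" and uw: "(u, w) \<in> parcs G"
  shows "var u * var w \<in> carrier (polynomial_ring (pverts G))"
  using arc_verts[OF G uw] by (simp add: carrier_polynomial_ring var_def mult_single keys_add_nat)

lemma edge_ideal_ideal:
  assumes G: "pair_graph G"
  shows "ideal (edge_ideal G) (polynomial_ring (pverts G) :: (('a \<Rightarrow>\<^sub>0 nat) \<Rightarrow>\<^sub>0 'k::field) ring)"
proof -
  interpret S: cring "polynomial_ring (pverts G) :: (('a \<Rightarrow>\<^sub>0 nat) \<Rightarrow>\<^sub>0 'k) ring" by (rule cring_polynomial_ring)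
  show ?thesis
    unfolding edge_ideal_def by (rule S.genideal_ideal) (use edge_monomial_carrier[OF G] in blast)
qed

text \<open>
  Every edge has an end point outside the independent set \<open>B\<close>.
\<close>

lemma edge_ideal_subset_coordinate_prime:
  assumes G: "pair_graph G" and B: "B \<in> independent_sets G" and fin: "finite B"
  shows "edge_ideal G \<subseteq> (coordinate_prime (pverts G) B :: (('a \<Rightarrow>\<^sub>0 nat) \<Rightarrow>\<^sub>0 'k::field) set)"
proof -
  interpret S: cring "polynomial_ring (pverts G) :: (('a \<Rightarrow>\<^sub>0 nat) \<Rightarrow>\<^sub>0 'k) ring" by (rule cring_polynomial_ring)
  interpret P: primeideal "coordinate_prime (pverts G) B" "polynomial_ring (pverts G) :: (('a \<Rightarrow>\<^sub>0 nat) \<Rightarrow>\<^sub>0 'k) ring"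
    by (rule coordinate_prime_primeideal[OF fin])
  show ?thesis unfolding edge_ideal_def
  proof (rule S.genideal_minimal[OF P.is_ideal])
    show "{var u * var w | u w. (u, w) \<in> parcs G} \<subseteq> (coordinate_prime (pverts G) B :: (('a \<Rightarrow>\<^sub>0 nat) \<Rightarrow>\<^sub>0 'k) set)"
    proof clarify
      fix u w assume uw: "(u, w) \<in> parcs G"
      then have "\<not> {u, w} \<subseteq> B" using B by (auto simp: independent_sets_def)
      moreover have "supp (var u * var w :: ('a \<Rightarrow>\<^sub>0 nat) \<Rightarrow>\<^sub>0 'k)
          = {Poly_Mapping.single u 1 + Poly_Mapping.single w 1}"
        by (simp add: var_def mult_single)
      moreover have "supp (Poly_Mapping.single u (1::nat) + Poly_Mapping.single w 1) = {u, w}"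
        by (auto simp: keys_add_nat)
      moreover have "var u * var w \<in> carrier (polynomial_ring (pverts G) :: (('a \<Rightarrow>\<^sub>0 nat) \<Rightarrow>\<^sub>0 'k) ring)"
        by (rule edge_monomial_carrier[OF G uw])
      ultimately show "var u * var w \<in> (coordinate_prime (pverts G) B :: (('a \<Rightarrow>\<^sub>0 nat) \<Rightarrow>\<^sub>0 'k) set)"
        unfolding coordinate_prime_def by simp
    qed
  qed
qed

lemma sum_monomials: "p = (\<Sum>m\<in>supp p. Poly_Mapping.single m (lookup p m))"
proof (rule poly_mapping_eqI)
  fix k
  have "lookup (\<Sum>m\<in>supp p. Poly_Mapping.single m (lookup p m)) k = (\<Sum>m\<in>supp p. if m = k then lookup p k else 0)"
    unfolding lookup_sum by (intro sum.cong) (auto simp: lookup_single when_def)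
  also have "\<dots> = lookup p k" by (auto simp: in_keys_iff)
  finally show "lookup p k = lookup (\<Sum>m\<in>supp p. Poly_Mapping.single m (lookup p m)) k" by simp
qed

text \<open>
  The edge ideal is a monomial ideal: a polynomial belongs to it as soon as each of its monomials is
  divisible by \<open>x\<^sub>u x\<^sub>w\<close> for some edge \<open>uw\<close>.
\<close>

lemma mem_edge_ideal:
  fixes p :: "('a \<Rightarrow>\<^sub>0 nat) \<Rightarrow>\<^sub>0 'k::field"
  assumes G: "pair_graph G" and p: "p \<in> carrier (polynomial_ring (pverts G))"
    and edge: "\<And>m. m \<in> supp p \<Longrightarrow> \<exists>(u, w)\<in>parcs G. u \<in> supp m \<and> w \<in> supp m"
  shows "p \<in> edge_ideal G"
proof -
  interpret S: cring "polynomial_ring (pverts G) :: (('a \<Rightarrow>\<^sub>0 nat) \<Rightarrow>\<^sub>0 'k) ring" by (rule cring_polynomial_ring)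
  interpret I: ideal "edge_ideal G" "polynomial_ring (pverts G) :: (('a \<Rightarrow>\<^sub>0 nat) \<Rightarrow>\<^sub>0 'k) ring"
    by (rule edge_ideal_ideal[OF G])
  have gen: "{var u * var w | u w. (u, w) \<in> parcs G} \<subseteq> (edge_ideal G :: (('a \<Rightarrow>\<^sub>0 nat) \<Rightarrow>\<^sub>0 'k) set)"
    unfolding edge_ideal_def by (rule S.genideal_self) (use edge_monomial_carrier[OF G] in blast)
  have mon: "Poly_Mapping.single m (lookup p m) \<in> edge_ideal G" if m: "m \<in> supp p" for m
  proof -
    obtain u w where uw: "(u, w) \<in> parcs G" "u \<in> supp m" "w \<in> supp m" using edge[OF m] by blast
    have "u \<noteq> w" using arc_neq[OF G] uw(1) by blast
    define n where "n = m - (Poly_Mapping.single u 1 + Poly_Mapping.single w 1)"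
    have mn: "m = n + (Poly_Mapping.single u 1 + Poly_Mapping.single w 1)"
    proof (rule poly_mapping_eqI)
      fix k show "lookup m k = lookup (n + (Poly_Mapping.single u 1 + Poly_Mapping.single w 1)) k"
        using uw(2,3) \<open>u \<noteq> w\<close>
        by (auto simp: n_def lookup_add lookup_minus lookup_single when_def in_keys_iff)
    qed
    have "supp m \<subseteq> pverts G" using p m by (simp add: carrier_polynomial_ring)
    then have "supp n \<subseteq> pverts G" unfolding mn keys_add_nat by blast
    then have "Poly_Mapping.single n (lookup p m) \<in> carrier (polynomial_ring (pverts G))"
      by (rule single_carrier)
    moreover have "(var u * var w :: ('a \<Rightarrow>\<^sub>0 nat) \<Rightarrow>\<^sub>0 'k) \<in> edge_ideal G" using gen uw(1) by blast
    ultimately have "Poly_Mapping.single n (lookup p m) * (var u * var w) \<in> edge_ideal G"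
      using I.I_l_closed by fastforce
    moreover have "Poly_Mapping.single n (lookup p m) * (var u * var w) = Poly_Mapping.single m (lookup p m)"
      unfolding var_def mult_single mn[symmetric] by simp
    ultimately show ?thesis by simp
  qed
  have "(\<Sum>m\<in>A. Poly_Mapping.single m (lookup p m)) \<in> edge_ideal G" if "finite A" "A \<subseteq> supp p" for A
    using that
  proof (induction A rule: finite_induct)
    case empty
    then show ?case using I.zero_closed by simp
  next
    case (insert m A)
    then show ?case using I.a_closed[OF mon[of m]] by auto
  qed
  from this[of "supp p"] show ?thesis by (subst sum_monomials[of p]) simp
qed

definition squarefree_monomial :: "'a set \<Rightarrow> ('a \<Rightarrow>\<^sub>0 nat) \<Rightarrow>\<^sub>0 'k::field" where
  "squarefree_monomial F = Poly_Mapping.single (\<Sum>u\<in>F. Poly_Mapping.single u 1) 1"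

lemma keys_squarefree_exponent:
  "finite F \<Longrightarrow> supp (\<Sum>u\<in>F. Poly_Mapping.single u (1::nat)) = F"
  by (induction F rule: finite_induct) (auto simp: keys_add_nat)

lemma squarefree_monomial_carrier:
  "finite F \<Longrightarrow> F \<subseteq> V \<Longrightarrow> squarefree_monomial F \<in> carrier (polynomial_ring V)"
  unfolding squarefree_monomial_def by (rule single_carrier) (simp add: keys_squarefree_exponent del: One_nat_def)

lemma squarefree_monomial_notin:
  "finite F \<Longrightarrow> squarefree_monomial F \<notin> coordinate_prime V F"
  by (simp add: squarefree_monomial_def coordinate_prime_def keys_squarefree_exponent del: One_nat_def)

text \<open>
  A monomial involving a variable \<open>w \<notin> F\<close> becomes divisible by an edge after multiplication by
  \<open>\<Prod>\<^sub>u\<^sub>\<in>\<^sub>F x\<^sub>u\<close>, because by maximality \<open>w\<close> has a neighbour in \<open>F\<close>. So the prime belonging to \<open>F\<close>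
  annihilates this monomial in the edge ring.
\<close>

lemma coordinate_prime_mult_squarefree_monomial:
  fixes p :: "('a \<Rightarrow>\<^sub>0 nat) \<Rightarrow>\<^sub>0 'k::field"
  assumes G: "pair_graph G" and fin: "finite F" and FV: "F \<subseteq> pverts G"
    and maximal: "\<And>w. w \<in> pverts G - F \<Longrightarrow> \<exists>u\<in>F. (u, w) \<in> parcs G"
    and p: "p \<in> coordinate_prime (pverts G) F"
  shows "p * squarefree_monomial F \<in> edge_ideal G"
proof (rule mem_edge_ideal[OF G])
  interpret S: cring "polynomial_ring (pverts G) :: (('a \<Rightarrow>\<^sub>0 nat) \<Rightarrow>\<^sub>0 'k) ring" by (rule cring_polynomial_ring)
  have pc: "p \<in> carrier (polynomial_ring (pverts G))" using p by (simp add: coordinate_prime_def)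
  then show "p * squarefree_monomial F \<in> carrier (polynomial_ring (pverts G))"
    using S.m_closed[of p "squarefree_monomial F"] squarefree_monomial_carrier[OF fin FV] by simp
  fix m assume "m \<in> supp (p * squarefree_monomial F)"
  then obtain k where k: "k \<in> supp p" "m = k + (\<Sum>u\<in>F. Poly_Mapping.single u 1)"
    by (auto simp: squarefree_monomial_def simp del: One_nat_def elim!: keys_multE split: if_splits)
  then obtain w where w: "w \<in> supp k" "w \<notin> F" using p by (auto simp: coordinate_prime_def)
  then have "w \<in> pverts G" using pc k(1) by (auto simp: carrier_polynomial_ring)
  then obtain u where "u \<in> F" "(u, w) \<in> parcs G" using maximal w(2) by blast
  then show "\<exists>(u, w)\<in>parcs G. u \<in> supp m \<and> w \<in> supp m"
    using w unfolding k(2) keys_add_nat keys_squarefree_exponent[OF fin] by blast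
qed

section \<open>Algebraic dependence modulo a prime generated by variables\<close>

text \<open>
  A homogeneous linear system with more unknowns \<open>I\<close> than equations \<open>X\<close> has a nonzero solution. The
  induction eliminates one equation \<open>x\<close> with pivot \<open>i0\<close>.
\<close>

lemma linear_dependence:
  fixes a :: "'i \<Rightarrow> 'e \<Rightarrow> 'k::field"
  assumes "finite X" and "finite I" and "card X < card I"
  obtains c where "\<exists>i\<in>I. c i \<noteq> 0" and "\<And>x. x \<in> X \<Longrightarrow> (\<Sum>i\<in>I. c i * a i x) = 0"
proof -
  have "\<exists>c. (\<exists>i\<in>I. c i \<noteq> 0) \<and> (\<forall>x\<in>X. (\<Sum>i\<in>I. c i * a i x) = 0)"
    using assms
  proof (induction X arbitrary: I a rule: finite_induct)
    case empty
    then have "I \<noteq> {}" by auto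
    then show ?case by (intro exI[of _ "\<lambda>_. 1"]) auto
  next
    case (insert x X)
    show ?case
    proof (cases "\<forall>i\<in>I. a i x = 0")
      case True
      obtain c where "\<exists>i\<in>I. c i \<noteq> 0" "\<forall>y\<in>X. (\<Sum>i\<in>I. c i * a i y) = 0"
        using insert.IH[of I a] insert.prems insert.hyps by auto
      then show ?thesis using True by (intro exI[of _ c]) simp
    next
      case False
      then obtain i0 where i0: "i0 \<in> I" "a i0 x \<noteq> 0" by blast
      let ?J = "I - {i0}"
      define b where "b = (\<lambda>i y. a i y - a i x / a i0 x * a i0 y)"
      have "card X < card ?J" using insert i0 by simp
      then obtain c where c: "\<exists>i\<in>?J. c i \<noteq> 0" "\<forall>y\<in>X. (\<Sum>i\<in>?J. c i * b i y) = 0"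
        using insert.IH[of ?J b] insert.prems by auto
      let ?s = "\<Sum>i\<in>?J. c i * (a i x / a i0 x)"
      define d where "d = c(i0 := - ?s)"
      have sum_d: "(\<Sum>i\<in>I. d i * a i y) = (\<Sum>i\<in>?J. c i * b i y)" for y
      proof -
        have "(\<Sum>i\<in>I. d i * a i y) = d i0 * a i0 y + (\<Sum>i\<in>?J. d i * a i y)"
          using insert.prems i0 by (intro sum.remove) auto
        also have "(\<Sum>i\<in>?J. d i * a i y) = (\<Sum>i\<in>?J. c i * a i y)"
          by (intro sum.cong) (auto simp: d_def)
        also have "d i0 * a i0 y = - (\<Sum>i\<in>?J. c i * (a i x / a i0 x) * a i0 y)"
          by (simp add: d_def sum_distrib_right)
        finally show ?thesis by (simp add: b_def algebra_simps sum_subtractf)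
      qed
      have "b i x = 0" for i using i0 by (simp add: b_def)
      then have "(\<Sum>i\<in>I. d i * a i x) = 0" unfolding sum_d by simp
      moreover have "\<exists>i\<in>I. d i \<noteq> 0" using c(1) by (auto simp: d_def)
      ultimately show ?thesis using c(2) sum_d by (intro exI[of _ d]) auto
    qed
  qed
  then show ?thesis using that by blast
qed

lemma nat_pow_polynomial_ring [simp]: "p [^]\<^bsub>polynomial_ring V\<^esub> (n::nat) = p ^ n"
  by (induction n) (simp_all add: nat_pow_def mult.commute)

definition exponents_le :: "nat \<Rightarrow> (('a \<Rightarrow>\<^sub>0 nat) \<Rightarrow>\<^sub>0 'k::field) \<Rightarrow> bool" where
  "exponents_le D p \<longleftrightarrow> (\<forall>m\<in>supp p. \<forall>u. lookup m u \<le> D)"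

lemma exponents_le_mult:
  "exponents_le C p \<Longrightarrow> exponents_le D q \<Longrightarrow> exponents_le (C + D) (p * q)"
  unfolding exponents_le_def by (auto elim!: keys_multE simp: lookup_add intro!: add_mono)

lemma exponents_le_power: "exponents_le D p \<Longrightarrow> exponents_le (n * D) (p ^ n)"
proof (induction n)
  case 0
  then show ?case by (simp add: exponents_le_def)
next
  case (Suc n)
  then show ?case using exponents_le_mult[of D p "n * D" "p ^ n"] by simp
qed

lemma exponents_le_mono: "exponents_le C p \<Longrightarrow> C \<le> D \<Longrightarrow> exponents_le D p"
  unfolding exponents_le_def by (meson order_trans)

lemma exponents_le_power_product:
  assumes "\<And>p. p \<in> set ps \<Longrightarrow> exponents_le D p" and "set e \<subseteq> {..N}" and "length e = length ps"
  shows "exponents_le (length ps * (N * D)) (power_product (polynomial_ring V) ps e)"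
  using assms
proof (induction ps arbitrary: e)
  case Nil
  then show ?case by (simp add: exponents_le_def)
next
  case (Cons p ps)
  obtain k e' where e: "e = k # e'" using Cons.prems(3) by (cases e) auto
  have "exponents_le (N * D) (p ^ k)"
    using exponents_le_mono[OF exponents_le_power[of D p k], of "N * D"] Cons.prems(1,2) e by simp
  moreover have "exponents_le (length ps * (N * D)) (power_product (polynomial_ring V) ps e')"
    using Cons.prems e by (intro Cons.IH) auto
  ultimately show ?case
    using exponents_le_mult[of "N * D" "p ^ k" "length ps * (N * D)" "power_product (polynomial_ring V) ps e'"]
    by (simp add: e)
qed

lemma obtain_exponents_le:
  fixes ps :: "(('a \<Rightarrow>\<^sub>0 nat) \<Rightarrow>\<^sub>0 'k::field) list"
  obtains D where "\<And>p. p \<in> set ps \<Longrightarrow> exponents_le D p"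
proof -
  define X where "X = insert 0 (\<Union>p\<in>set ps. \<Union>m\<in>supp p. lookup m ` supp m)"
  have X: "finite X" by (simp add: X_def)
  have "lookup m u \<in> X" if "p \<in> set ps" "m \<in> supp p" for p m u
  proof (cases "u \<in> supp m")
    case True
    then show ?thesis using that unfolding X_def by blast
  next
    case False
    then show ?thesis by (simp add: X_def in_keys_iff)
  qed
  then have "exponents_le (Max X) p" if "p \<in> set ps" for p
    using that X by (auto simp: exponents_le_def)
  then show ?thesis using that by blast
qed

lemma card_bounded_monomials:
  assumes F: "finite F"
  shows "finite {m :: 'a \<Rightarrow>\<^sub>0 nat. supp m \<subseteq> F \<and> (\<forall>u. lookup m u \<le> Q)}"
    and "card {m :: 'a \<Rightarrow>\<^sub>0 nat. supp m \<subseteq> F \<and> (\<forall>u. lookup m u \<le> Q)} \<le> Suc Q ^ card F"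
proof -
  let ?M = "{m :: 'a \<Rightarrow>\<^sub>0 nat. supp m \<subseteq> F \<and> (\<forall>u. lookup m u \<le> Q)}"
  let ?r = "\<lambda>m :: 'a \<Rightarrow>\<^sub>0 nat. restrict (lookup m) F"
  have inj: "inj_on ?r ?M"
  proof (rule inj_onI, rule poly_mapping_eqI)
    fix m n u assume mn: "m \<in> ?M" "n \<in> ?M" "?r m = ?r n"
    show "lookup m u = lookup n u"
    proof (cases "u \<in> F")
      case True
      then show ?thesis using fun_cong[OF mn(3), of u] by simp
    next
      case False
      then have "u \<notin> supp m" "u \<notin> supp n" using mn by auto
      then show ?thesis by (simp add: in_keys_iff)
    qed
  qed
  have im: "?r ` ?M \<subseteq> F \<rightarrow>\<^sub>E {..Q}" by (auto simp: PiE_iff)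
  have fin: "finite (F \<rightarrow>\<^sub>E {..Q})" using F by (intro finite_PiE) auto
  show "finite ?M" using inj_on_finite[OF inj im fin] .
  have "card ?M \<le> card (F \<rightarrow>\<^sub>E {..Q})" by (rule card_inj_on_le[OF inj im fin])
  also have "\<dots> = Suc Q ^ card F" using F by (simp add: card_PiE)
  finally show "card ?M \<le> Suc Q ^ card F" .
qed

text \<open>
  Counting argument: the power products with all exponents at most \<open>N\<close> number \<open>(N + 1)\<^sup>r\<close>, where \<open>r\<close> is
  the number of polynomials, whereas the monomials in the variables \<open>F\<close> that occur in them number at
  most \<open>(r N D + 1)\<^bsup>|F|\<^esup>\<close> if \<open>D\<close> bounds the exponents of the given polynomials. Since \<open>r > |F|\<close>, the
  former exceed the latter for large \<open>N\<close>, and some nontrivial combination of the power products has no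
  monomial in the variables \<open>F\<close> alone.
\<close>

theorem algebraic_dependence:
  fixes ps :: "(('a \<Rightarrow>\<^sub>0 nat) \<Rightarrow>\<^sub>0 'k::field) list"
  assumes F: "finite F" and ps: "set ps \<subseteq> carrier (polynomial_ring V)" and card: "card F < length ps"
  obtains E c where "finite E" and "E \<noteq> {}" and "\<And>e. e \<in> E \<Longrightarrow> length e = length ps"
    and "\<And>e. e \<in> E \<Longrightarrow> c e \<noteq> 0"
    and "(\<Sum>e\<in>E. Poly_Mapping.single 0 (c e) * power_product (polynomial_ring V) ps e)
      \<in> coordinate_prime V F"
proof -
  interpret S: cring "polynomial_ring V :: (('a \<Rightarrow>\<^sub>0 nat) \<Rightarrow>\<^sub>0 'k) ring" by (rule cring_polynomial_ring)
  obtain D where D: "\<And>p. p \<in> set ps \<Longrightarrow> exponents_le D p" using obtain_exponents_le by blast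
  let ?r = "length ps" and ?d = "card F"
  \<comment> \<open>\<open>(r N D + 1)\<^sup>d \<le> (r D + 1)\<^sup>d (N + 1)\<^sup>d\<close>, so \<open>N = (r D + 1)\<^sup>d\<close> suffices\<close>
  define N where "N = Suc (?r * D) ^ ?d"
  define I where "I = {e :: nat list. set e \<subseteq> {..N} \<and> length e = ?r}"
  define M where "M = {m :: 'a \<Rightarrow>\<^sub>0 nat. supp m \<subseteq> F \<and> (\<forall>u. lookup m u \<le> ?r * (N * D))}"
  have I: "finite I" "card I = Suc N ^ ?r"
    by (simp_all add: I_def finite_lists_length_eq card_lists_length_eq)
  have "card M \<le> Suc (?r * (N * D)) ^ ?d" unfolding M_def by (rule card_bounded_monomials[OF F])
  also have "\<dots> \<le> (Suc (?r * D) * Suc N) ^ ?d" by (intro power_mono) (auto simp: algebra_simps)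
  also have "\<dots> = N * Suc N ^ ?d" by (simp only: power_mult_distrib N_def)
  also have "\<dots> < Suc N * Suc N ^ ?d" by simp
  also have "\<dots> = Suc N ^ Suc ?d" by simp
  also have "\<dots> \<le> Suc N ^ ?r" using card by (intro power_increasing) auto
  finally have "card M < card I" using I by simp
  moreover have "finite M" unfolding M_def by (rule card_bounded_monomials[OF F])
  ultimately obtain c where c: "\<exists>e\<in>I. c e \<noteq> 0"
    and rel: "\<And>m. m \<in> M \<Longrightarrow> (\<Sum>e\<in>I. c e * lookup (power_product (polynomial_ring V) ps e) m) = 0"
    using linear_dependence[of M I "\<lambda>e. lookup (power_product (polynomial_ring V) ps e)"] I(1) by metis
  define E where "E = {e \<in> I. c e \<noteq> 0}"
  let ?q = "\<Sum>e\<in>E. Poly_Mapping.single 0 (c e) * power_product (polynomial_ring V) ps e"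
  have pc: "power_product (polynomial_ring V) ps e \<in> carrier (polynomial_ring V)" for e
    using S.power_product_closed[OF ps] .
  have tc: "Poly_Mapping.single 0 (c e) * power_product (polynomial_ring V) ps e \<in> carrier (polynomial_ring V)" for e
    using S.m_closed[OF single_carrier[of 0 V "c e"] pc] by simp
  have q: "?q \<in> carrier (polynomial_ring V)"
    unfolding carrier_polynomial_ring
  proof
    fix m assume "m \<in> supp ?q"
    then obtain e where "m \<in> supp (Poly_Mapping.single 0 (c e) * power_product (polynomial_ring V) ps e)"
      using keys_sum[of "\<lambda>e. Poly_Mapping.single 0 (c e) * power_product (polynomial_ring V) ps e" E] by blast
    then show "supp m \<subseteq> V" using tc[of e] by (simp add: carrier_polynomial_ring)
  qed
  have lq: "lookup ?q m = (\<Sum>e\<in>I. c e * lookup (power_product (polynomial_ring V) ps e) m)" for m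
  proof -
    have "lookup ?q m = (\<Sum>e\<in>E. c e * lookup (power_product (polynomial_ring V) ps e) m)"
      unfolding lookup_sum
      by (intro sum.cong) (simp_all add: mult_map_scale_conv_mult[symmetric] Poly_Mapping.map.rep_eq when_def)
    also have "\<dots> = (\<Sum>e\<in>I. c e * lookup (power_product (polynomial_ring V) ps e) m)"
      by (intro sum.mono_neutral_left) (auto simp: E_def I(1))
    finally show ?thesis .
  qed
  have "\<not> supp m \<subseteq> F" if m: "m \<in> supp ?q" for m
  proof
    assume mF: "supp m \<subseteq> F"
    have nz: "lookup ?q m \<noteq> 0" using m by (simp add: in_keys_iff)
    then obtain e where e: "e \<in> I" "lookup (power_product (polynomial_ring V) ps e) m \<noteq> 0"
      unfolding lq by (metis (no_types, lifting) mult_zero_right sum.neutral)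
    have "exponents_le (?r * (N * D)) (power_product (polynomial_ring V) ps e)"
      using e(1) by (intro exponents_le_power_product D) (auto simp: I_def)
    then have "m \<in> M" using e(2) mF by (auto simp: M_def exponents_le_def in_keys_iff)
    then show False using rel nz lq by simp
  qed
  then have "?q \<in> coordinate_prime V F" using q by (simp add: coordinate_prime_def)
  moreover have "finite E" "E \<noteq> {}" using I(1) c by (auto simp: E_def)
  moreover have "length e = ?r" "c e \<noteq> 0" if "e \<in> E" for e using that by (simp_all add: E_def I_def)
  ultimately show ?thesis using that by blast
qed

section \<open>Localizations\<close>

locale multiplicative_set = cring R for R (structure) and S +
  assumes S_carrier: "S \<subseteq> carrier R"
    and S_one: "\<one> \<in> S"
    and S_mult: "s \<in> S \<Longrightarrow> t \<in> S \<Longrightarrow> s \<otimes> t \<in> S"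
begin

lemma S_closed: "s \<in> S \<Longrightarrow> s \<in> carrier R" using S_carrier by blast

lemma equiv_fraction_rel: "equiv (carrier R \<times> S) (fraction_rel R S)"
proof (rule equivI)
  note [simp] = S_closed
  show "fraction_rel R S \<subseteq> (carrier R \<times> S) \<times> (carrier R \<times> S)"
    by (auto simp: fraction_rel_def)
  show "refl_on (carrier R \<times> S) (fraction_rel R S)"
    using S_one by (auto simp: refl_on_def fraction_rel_def)
  show "sym (fraction_rel R S)"
    by (auto simp: sym_def fraction_rel_def) (metis)
  show "trans (fraction_rel R S)"
  proof (rule transI, clarsimp simp: fraction_rel_def)
    fix a s b t c r u w
    assume a: "a \<in> carrier R" "b \<in> carrier R" "c \<in> carrier R" and S: "s \<in> S" "t \<in> S" "r \<in> S" "u \<in> S" "w \<in> S"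
      and 1: "u \<otimes> (t \<otimes> a) = u \<otimes> (s \<otimes> b)" and 2: "w \<otimes> (r \<otimes> b) = w \<otimes> (t \<otimes> c)"
    have "(u \<otimes> w \<otimes> t) \<otimes> (r \<otimes> a) = (w \<otimes> r) \<otimes> (u \<otimes> (t \<otimes> a))"
      using a S by (simp add: m_ac)
    also have "\<dots> = (u \<otimes> s) \<otimes> (w \<otimes> (r \<otimes> b))" unfolding 1 using a S by (simp add: m_ac)
    also have "\<dots> = (u \<otimes> w \<otimes> t) \<otimes> (s \<otimes> c)" unfolding 2 using a S by (simp add: m_ac)
    finally show "\<exists>v\<in>S. v \<otimes> (r \<otimes> a) = v \<otimes> (s \<otimes> c)"
      using S by (intro bexI[of _ "u \<otimes> w \<otimes> t"]) (auto intro!: S_mult)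
  qed
qed

lemma fraction_eq_iff:
  assumes "a \<in> carrier R" "s \<in> S" "b \<in> carrier R" "t \<in> S"
  shows "fraction R S a s = fraction R S b t \<longleftrightarrow> (\<exists>u\<in>S. u \<otimes> (t \<otimes> a) = u \<otimes> (s \<otimes> b))"
proof -
  have "fraction R S a s = fraction R S b t \<longleftrightarrow> ((a, s), (b, t)) \<in> fraction_rel R S"
    unfolding fraction_def using assms by (intro eq_equiv_class_iff[OF equiv_fraction_rel]) auto
  then show ?thesis using assms by (simp add: fraction_rel_def)
qed

lemma mem_fraction:
  assumes "(b, t) \<in> fraction R S a s"
  shows "a \<in> carrier R \<and> s \<in> S \<and> b \<in> carrier R \<and> t \<in> S \<and> (\<exists>u\<in>S. u \<otimes> (t \<otimes> a) = u \<otimes> (s \<otimes> b))"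
  using assms by (simp add: fraction_def fraction_rel_def)

lemma self_mem_fraction: "a \<in> carrier R \<Longrightarrow> s \<in> S \<Longrightarrow> (a, s) \<in> fraction R S a s"
  using S_one by (auto simp: fraction_def fraction_rel_def)

text \<open>
  The operations of the localization are unions over all representatives. They can be evaluated on
  chosen representatives once the result is known not to depend on the choice.
\<close>

lemma UN_fraction:
  assumes "a \<in> carrier R" "s \<in> S" "b \<in> carrier R" "t \<in> S"
    and const: "\<And>a' s' b' t'. (a', s') \<in> fraction R S a s \<Longrightarrow> (b', t') \<in> fraction R S b t \<Longrightarrow> h a' s' b' t' = C"
  shows "(\<Union>(a', s')\<in>fraction R S a s. \<Union>(b', t')\<in>fraction R S b t. h a' s' b' t') = C"
proof
  show "(\<Union>(a', s')\<in>fraction R S a s. \<Union>(b', t')\<in>fraction R S b t. h a' s' b' t') \<subseteq> C"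
    using const by fastforce
  have "h a s b t \<subseteq> (\<Union>(a', s')\<in>fraction R S a s. \<Union>(b', t')\<in>fraction R S b t. h a' s' b' t')"
    using self_mem_fraction[OF assms(1,2)] self_mem_fraction[OF assms(3,4)] by blast
  then show "C \<subseteq> (\<Union>(a', s')\<in>fraction R S a s. \<Union>(b', t')\<in>fraction R S b t. h a' s' b' t')"
    using const[OF self_mem_fraction[OF assms(1,2)] self_mem_fraction[OF assms(3,4)]] by simp
qed

lemma mult_fraction:
  assumes "a \<in> carrier R" "s \<in> S" "b \<in> carrier R" "t \<in> S"
  shows "fraction R S a s \<otimes>\<^bsub>localization R S\<^esub> fraction R S b t = fraction R S (a \<otimes> b) (s \<otimes> t)"
  unfolding localization_def monoid.simps
proof (rule UN_fraction[OF assms])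
  note [simp] = S_closed
  fix a' s' b' t' assume "(a', s') \<in> fraction R S a s" "(b', t') \<in> fraction R S b t"
  then obtain u w where *: "a' \<in> carrier R" "s' \<in> S" "b' \<in> carrier R" "t' \<in> S" "u \<in> S" "w \<in> S"
    and 1: "u \<otimes> (s' \<otimes> a) = u \<otimes> (s \<otimes> a')" and 2: "w \<otimes> (t' \<otimes> b) = w \<otimes> (t \<otimes> b')"
    by (auto dest!: mem_fraction)
  have "(u \<otimes> w) \<otimes> ((s \<otimes> t) \<otimes> (a' \<otimes> b')) = (u \<otimes> (s \<otimes> a')) \<otimes> (w \<otimes> (t \<otimes> b'))"
    using * assms by (simp add: m_ac)
  also have "\<dots> = (u \<otimes> w) \<otimes> ((s' \<otimes> t') \<otimes> (a \<otimes> b))"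
    unfolding 1[symmetric] 2[symmetric] using * assms by (simp add: m_ac)
  finally show "fraction R S (a' \<otimes> b') (s' \<otimes> t') = fraction R S (a \<otimes> b) (s \<otimes> t)"
    using * assms S_mult by (subst fraction_eq_iff) auto
qed

lemma add_fraction:
  assumes "a \<in> carrier R" "s \<in> S" "b \<in> carrier R" "t \<in> S"
  shows "fraction R S a s \<oplus>\<^bsub>localization R S\<^esub> fraction R S b t
    = fraction R S ((t \<otimes> a) \<oplus> (s \<otimes> b)) (s \<otimes> t)"
  unfolding localization_def ring.simps
proof (rule UN_fraction[OF assms])
  note [simp] = S_closed
  fix a' s' b' t' assume "(a', s') \<in> fraction R S a s" "(b', t') \<in> fraction R S b t"
  then obtain u w where *: "a' \<in> carrier R" "s' \<in> S" "b' \<in> carrier R" "t' \<in> S" "u \<in> S" "w \<in> S"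
    and 1: "u \<otimes> (s' \<otimes> a) = u \<otimes> (s \<otimes> a')" and 2: "w \<otimes> (t' \<otimes> b) = w \<otimes> (t \<otimes> b')"
    by (auto dest!: mem_fraction)
  have "(u \<otimes> w) \<otimes> ((s \<otimes> t) \<otimes> ((t' \<otimes> a') \<oplus> (s' \<otimes> b')))
      = (w \<otimes> t \<otimes> t') \<otimes> (u \<otimes> (s \<otimes> a')) \<oplus> (u \<otimes> s \<otimes> s') \<otimes> (w \<otimes> (t \<otimes> b'))"
    using * assms by (simp add: m_ac r_distr)
  also have "\<dots> = (u \<otimes> w) \<otimes> ((s' \<otimes> t') \<otimes> ((t \<otimes> a) \<oplus> (s \<otimes> b)))"
    unfolding 1[symmetric] 2[symmetric] using * assms by (simp add: m_ac r_distr)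
  finally show "fraction R S ((t' \<otimes> a') \<oplus> (s' \<otimes> b')) (s' \<otimes> t')
      = fraction R S ((t \<otimes> a) \<oplus> (s \<otimes> b)) (s \<otimes> t)"
    using * assms S_mult by (subst fraction_eq_iff) auto
qed

lemma one_localization: "\<one>\<^bsub>localization R S\<^esub> = fraction R S \<one> \<one>"
  and zero_localization: "\<zero>\<^bsub>localization R S\<^esub> = fraction R S \<zero> \<one>"
  by (simp_all add: localization_def)

lemma fraction_carrier: "a \<in> carrier R \<Longrightarrow> s \<in> S \<Longrightarrow> fraction R S a s \<in> carrier (localization R S)"
  by (auto simp: localization_def fraction_def intro: quotientI)

lemma carrier_localizationE:
  assumes "z \<in> carrier (localization R S)"
  obtains a s where "a \<in> carrier R" "s \<in> S" "z = fraction R S a s"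
  using assms by (auto simp: localization_def fraction_def elim!: quotientE)

lemma localization_hom: "(\<lambda>a. fraction R S a \<one>) \<in> ring_hom R (localization R S)"
  by (rule ring_hom_memI) (simp_all add: fraction_carrier S_one mult_fraction add_fraction one_localization)

lemma clear_denominator:
  assumes "a \<in> carrier R" "s \<in> S"
  shows "fraction R S s \<one> \<otimes>\<^bsub>localization R S\<^esub> fraction R S a s = fraction R S a \<one>"
proof -
  note [simp] = S_closed
  have "fraction R S s \<one> \<otimes>\<^bsub>localization R S\<^esub> fraction R S a s = fraction R S (s \<otimes> a) (\<one> \<otimes> s)"
    using assms S_one by (intro mult_fraction) auto
  also have "\<dots> = fraction R S a \<one>"
    using assms S_one by (subst fraction_eq_iff) auto
  finally show ?thesis .
qed

lemma fraction_inverse: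
  assumes "s \<in> S"
  shows "fraction R S s \<one> \<otimes>\<^bsub>localization R S\<^esub> fraction R S \<one> s = \<one>\<^bsub>localization R S\<^esub>"
  unfolding one_localization by (rule clear_denominator) (use assms in auto)

end

lemma (in ring) carrier_quotE:
  assumes "x \<in> carrier (R Quot I)"
  obtains r where "r \<in> carrier R" "x = I +> r"
  using assms unfolding FactRing_def A_RCOSETS_def'[of R I] by auto

lemma (in ring) mem_image_quot_iff:
  assumes I: "ideal I R" and P: "ideal P R" "I \<subseteq> P" and p: "p \<in> carrier R"
  shows "I +> p \<in> (+>) I ` P \<longleftrightarrow> p \<in> P"
proof
  assume "I +> p \<in> (+>) I ` P"
  then obtain q where q: "q \<in> P" "I +> p = I +> q" by blast
  have qc: "q \<in> carrier R" using q(1) by (rule ideal.Icarr[OF P(1)])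
  have "p \<ominus> q \<in> P" using quotient_eq_iff_same_a_r_cos[OF I p qc] q(2) P(2) by blast
  then have "(p \<ominus> q) \<oplus> q \<in> P" using q(1) additive_subgroup.a_closed[OF ideal.axioms(1)[OF P(1)]] by blast
  moreover have "(p \<ominus> q) \<oplus> q = p" using p qc by algebra
  ultimately show "p \<in> P" by simp
qed blast

lemma (in ring) maximalideal_quot:
  assumes I: "ideal I R" and P: "maximalideal P R" "I \<subseteq> P"
  shows "maximalideal ((+>) I ` P) (R Quot I)"
proof -
  interpret P: maximalideal P R by (rule P(1))
  show ?thesis
  proof (rule maximalidealI)
    show "ideal ((+>) I ` P) (R Quot I)" by (rule ring_ideal_imp_quot_ideal[OF I P.is_ideal])
    have "\<one> \<notin> P" using P.one_imp_carrier P.I_notcarr by blast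
    then have "I +> \<one> \<notin> (+>) I ` P" using mem_image_quot_iff[OF I P.is_ideal P(2)] by simp
    moreover have "I +> \<one> \<in> carrier (R Quot I)"
      using ring_hom_closed[OF ideal.rcos_ring_hom[OF I]] by simp
    ultimately show "carrier (R Quot I) \<noteq> (+>) I ` P" by blast
    fix J assume J: "ideal J (R Quot I)" "(+>) I ` P \<subseteq> J" "J \<subseteq> carrier (R Quot I)"
    have "ideal (\<Union>J) R" by (rule quot_ideal_imp_ring_ideal[OF I J(1)])
    moreover have "P \<subseteq> \<Union>J"
      using canonical_proj_vimage_mem_iff[OF I J(3)] J(2) P.Icarr by blast
    moreover have "\<Union>J \<subseteq> carrier R" by (rule canonical_proj_vimage_in_carrier[OF I J(3)])
    ultimately consider "\<Union>J = P" | "\<Union>J = carrier R" using P.I_maximal by blast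
    then show "J = (+>) I ` P \<or> J = carrier (R Quot I)"
    proof cases
      case 1
      have "x \<in> (+>) I ` P" if "x \<in> J" for x
      proof -
        have "x \<in> carrier (R Quot I)" using that J(3) by blast
        then obtain r where "r \<in> carrier R" "x = I +> r" by (rule carrier_quotE)
        then show ?thesis using canonical_proj_vimage_mem_iff[OF I J(3), of r] that 1 by blast
      qed
      then show ?thesis using J(2) by blast
    next
      case 2
      have "x \<in> J" if x: "x \<in> carrier (R Quot I)" for x
      proof -
        obtain r where "r \<in> carrier R" "x = I +> r" using x by (rule carrier_quotE)
        then show ?thesis using canonical_proj_vimage_mem_iff[OF I J(3), of r] 2 by blast
      qed
      then show ?thesis using J(3) by blast
    qed
  qed
qed

text \<open>
  A homomorphism \<open>\<pi>\<close> that presents \<open>L\<close> as the localization of \<open>S / I\<close> at the image of \<open>T\<close>. Working with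
  this characterization hides both the cosets and the classes of fractions: elements of \<open>L\<close> are handled
  through numerators and denominators in \<open>S\<close>.
\<close>

locale localization_map = S: cring S + L: cring L for S (structure) and L (structure) +
  fixes \<pi> :: "'a \<Rightarrow> 'c" and T I :: "'a set"
  assumes hom: "\<pi> \<in> ring_hom S L"
    and T_carrier: "T \<subseteq> carrier S"
    and T_one: "\<one>\<^bsub>S\<^esub> \<in> T"
    and T_mult: "s \<in> T \<Longrightarrow> t \<in> T \<Longrightarrow> s \<otimes>\<^bsub>S\<^esub> t \<in> T"
    and unit: "t \<in> T \<Longrightarrow> \<pi> t \<in> Units L"
    and zero: "p \<in> I \<Longrightarrow> \<pi> p = \<zero>\<^bsub>L\<^esub>"
    and kernel: "p \<in> carrier S \<Longrightarrow> \<pi> p = \<zero>\<^bsub>L\<^esub> \<Longrightarrow> \<exists>t\<in>T. t \<otimes>\<^bsub>S\<^esub> p \<in> I"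
    and surj: "z \<in> carrier L \<Longrightarrow> \<exists>t\<in>T. \<exists>p\<in>carrier S. \<pi> t \<otimes>\<^bsub>L\<^esub> z = \<pi> p"
begin

sublocale h: ring_hom_cring S L \<pi>
  using hom by unfold_locales

definition extension :: "'a set \<Rightarrow> 'c set" where
  "extension P = {z \<in> carrier L. \<exists>t\<in>T. \<exists>p\<in>P. \<pi> t \<otimes>\<^bsub>L\<^esub> z = \<pi> p}"

lemma T_closed: "t \<in> T \<Longrightarrow> t \<in> carrier S" using T_carrier by blast

text \<open>
  Extension to \<open>L\<close> loses no information on a prime that contains \<open>I\<close> and misses the denominators; hence
  strict inclusions between such primes are preserved.
\<close>

lemma image_mem_extension_iff:
  assumes P: "primeideal P S" and IP: "I \<subseteq> P" and disj: "P \<inter> T = {}" and q: "q \<in> carrier S"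
  shows "\<pi> q \<in> extension P \<longleftrightarrow> q \<in> P"
proof
  note [simp] = T_closed
  interpret P: primeideal P S by (rule P)
  assume "\<pi> q \<in> extension P"
  then obtain t p where tp: "t \<in> T" "p \<in> P" and eq: "\<pi> t \<otimes>\<^bsub>L\<^esub> \<pi> q = \<pi> p"
    by (auto simp: extension_def)
  have c: "t \<in> carrier S" "p \<in> carrier S" using tp P.Icarr by auto
  have "\<pi> (t \<otimes>\<^bsub>S\<^esub> q \<ominus>\<^bsub>S\<^esub> p) = \<pi> p \<ominus>\<^bsub>L\<^esub> \<pi> p"
    using c q by (simp add: a_minus_def eq)
  also have "\<dots> = \<zero>\<^bsub>L\<^esub>" using c by (simp add: L.r_neg a_minus_def)
  finally obtain s where s: "s \<in> T" "s \<otimes>\<^bsub>S\<^esub> (t \<otimes>\<^bsub>S\<^esub> q \<ominus>\<^bsub>S\<^esub> p) \<in> I"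
    using kernel[of "t \<otimes>\<^bsub>S\<^esub> q \<ominus>\<^bsub>S\<^esub> p"] c q by auto
  have "t \<otimes>\<^bsub>S\<^esub> q \<ominus>\<^bsub>S\<^esub> p \<in> P" using P.I_prime[of s "t \<otimes>\<^bsub>S\<^esub> q \<ominus>\<^bsub>S\<^esub> p"] s c q IP disj by auto
  then have "(t \<otimes>\<^bsub>S\<^esub> q \<ominus>\<^bsub>S\<^esub> p) \<oplus>\<^bsub>S\<^esub> p \<in> P" using tp(2) by (rule P.a_closed)
  moreover have "(t \<otimes>\<^bsub>S\<^esub> q \<ominus>\<^bsub>S\<^esub> p) \<oplus>\<^bsub>S\<^esub> p = t \<otimes>\<^bsub>S\<^esub> q" using c q by algebra
  ultimately have "t \<otimes>\<^bsub>S\<^esub> q \<in> P" by simp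
  then show "q \<in> P" using P.I_prime[of t q] tp disj q by auto
next
  assume "q \<in> P"
  moreover have "\<pi> \<one>\<^bsub>S\<^esub> \<otimes>\<^bsub>L\<^esub> \<pi> q = \<pi> q" using q by simp
  ultimately show "\<pi> q \<in> extension P"
    using q T_one unfolding extension_def by blast
qed

lemma extension_primeideal:
  assumes P: "primeideal P S" and IP: "I \<subseteq> P" and disj: "P \<inter> T = {}"
  shows "primeideal (extension P) L"
proof -
  note [simp] = T_closed
  interpret P: primeideal P S by (rule P)
  note image_iff = image_mem_extension_iff[OF P IP disj]
  have l: "x \<otimes>\<^bsub>L\<^esub> a \<in> extension P" if a: "a \<in> extension P" and x: "x \<in> carrier L" for a x
  proof -
    obtain t p where tp: "a \<in> carrier L" "t \<in> T" "p \<in> P" "\<pi> t \<otimes>\<^bsub>L\<^esub> a = \<pi> p"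
      using a by (auto simp: extension_def)
    obtain s q where sq: "s \<in> T" "q \<in> carrier S" "\<pi> s \<otimes>\<^bsub>L\<^esub> x = \<pi> q" using surj[OF x] by blast
    have "\<pi> (s \<otimes>\<^bsub>S\<^esub> t) \<otimes>\<^bsub>L\<^esub> (x \<otimes>\<^bsub>L\<^esub> a) = (\<pi> s \<otimes>\<^bsub>L\<^esub> x) \<otimes>\<^bsub>L\<^esub> (\<pi> t \<otimes>\<^bsub>L\<^esub> a)"
      using tp(1,2) sq(1) x by (simp add: L.m_ac)
    also have "\<dots> = \<pi> (q \<otimes>\<^bsub>S\<^esub> p)" using tp sq P.Icarr by simp
    finally show ?thesis
      using T_mult[OF sq(1) tp(2)] P.I_l_closed[OF tp(3) sq(2)] x tp(1)
      unfolding extension_def by blast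
  qed
  show ?thesis
  proof (rule primeidealI)
    show "cring L" by (rule L.is_cring)
    show "ideal (extension P) L"
    proof (rule idealI)
      show "ring L" by (rule L.ring_axioms)
      show "subgroup (extension P) (add_monoid L)"
      proof (rule L.add.subgroupI)
        show "extension P \<subseteq> carrier L" by (auto simp: extension_def)
        show "extension P \<noteq> {}" using image_iff[of "\<zero>\<^bsub>S\<^esub>"] P.zero_closed by auto
        show "\<ominus>\<^bsub>L\<^esub> a \<in> extension P" if "a \<in> extension P" for a
        proof -
          have "a \<in> carrier L" using that by (simp add: extension_def)
          then have "\<ominus>\<^bsub>L\<^esub> a = (\<ominus>\<^bsub>L\<^esub> \<one>\<^bsub>L\<^esub>) \<otimes>\<^bsub>L\<^esub> a" by (simp add: L.l_minus)
          then show ?thesis using l[OF that] by simp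
        qed
        show "a \<oplus>\<^bsub>L\<^esub> b \<in> extension P" if a: "a \<in> extension P" and b: "b \<in> extension P" for a b
        proof -
          obtain t p where tp: "a \<in> carrier L" "t \<in> T" "p \<in> P" "\<pi> t \<otimes>\<^bsub>L\<^esub> a = \<pi> p"
            using a by (auto simp: extension_def)
          obtain s q where sq: "b \<in> carrier L" "s \<in> T" "q \<in> P" "\<pi> s \<otimes>\<^bsub>L\<^esub> b = \<pi> q"
            using b by (auto simp: extension_def)
          have "\<pi> (s \<otimes>\<^bsub>S\<^esub> t) \<otimes>\<^bsub>L\<^esub> (a \<oplus>\<^bsub>L\<^esub> b)
              = \<pi> s \<otimes>\<^bsub>L\<^esub> (\<pi> t \<otimes>\<^bsub>L\<^esub> a) \<oplus>\<^bsub>L\<^esub> \<pi> t \<otimes>\<^bsub>L\<^esub> (\<pi> s \<otimes>\<^bsub>L\<^esub> b)"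
            using tp(1,2) sq(1,2) by (simp add: L.m_ac L.r_distr)
          also have "\<dots> = \<pi> (s \<otimes>\<^bsub>S\<^esub> p \<oplus>\<^bsub>S\<^esub> t \<otimes>\<^bsub>S\<^esub> q)"
            using tp sq P.Icarr by simp
          finally have eq: "\<pi> (s \<otimes>\<^bsub>S\<^esub> t) \<otimes>\<^bsub>L\<^esub> (a \<oplus>\<^bsub>L\<^esub> b) = \<pi> (s \<otimes>\<^bsub>S\<^esub> p \<oplus>\<^bsub>S\<^esub> t \<otimes>\<^bsub>S\<^esub> q)" .
          have "s \<otimes>\<^bsub>S\<^esub> p \<oplus>\<^bsub>S\<^esub> t \<otimes>\<^bsub>S\<^esub> q \<in> P"
            using tp sq by (simp add: P.a_closed P.I_l_closed)
          then show ?thesis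
            using T_mult[OF sq(2) tp(2)] eq L.a_closed[OF tp(1) sq(1)] unfolding extension_def by blast
        qed
      qed
      show "x \<otimes>\<^bsub>L\<^esub> a \<in> extension P" if "a \<in> extension P" "x \<in> carrier L" for a x
        by (rule l[OF that])
      show "a \<otimes>\<^bsub>L\<^esub> x \<in> extension P" if "a \<in> extension P" "x \<in> carrier L" for a x
        using l[OF that] that L.m_comm[of a x] by (simp add: extension_def)
    qed
    have "\<one>\<^bsub>S\<^esub> \<notin> P" using P.one_imp_carrier P.I_notcarr by blast
    then have "\<one>\<^bsub>L\<^esub> \<notin> extension P" using image_iff[of "\<one>\<^bsub>S\<^esub>"] by simp
    then show "carrier L \<noteq> extension P" using L.one_closed by metis
    fix a b assume ab: "a \<in> carrier L" "b \<in> carrier L" "a \<otimes>\<^bsub>L\<^esub> b \<in> extension P"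
    obtain t p where tp: "t \<in> T" "p \<in> carrier S" "\<pi> t \<otimes>\<^bsub>L\<^esub> a = \<pi> p" using surj[OF ab(1)] by blast
    obtain s q where sq: "s \<in> T" "q \<in> carrier S" "\<pi> s \<otimes>\<^bsub>L\<^esub> b = \<pi> q" using surj[OF ab(2)] by blast
    have "\<pi> (p \<otimes>\<^bsub>S\<^esub> q) = (\<pi> t \<otimes>\<^bsub>L\<^esub> a) \<otimes>\<^bsub>L\<^esub> (\<pi> s \<otimes>\<^bsub>L\<^esub> b)" using tp sq by simp
    also have "\<dots> = (\<pi> t \<otimes>\<^bsub>L\<^esub> \<pi> s) \<otimes>\<^bsub>L\<^esub> (a \<otimes>\<^bsub>L\<^esub> b)" using ab tp(1) sq(1) by (simp add: L.m_ac)
    finally have "\<pi> (p \<otimes>\<^bsub>S\<^esub> q) \<in> extension P" using l[OF ab(3)] tp(1) sq(1) by simp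
    then have "p \<otimes>\<^bsub>S\<^esub> q \<in> P"
      using image_iff[OF S.m_closed[OF tp(2) sq(2)]] by blast
    then have "p \<in> P \<or> q \<in> P" using P.I_prime tp(2) sq(2) by blast
    then show "a \<in> extension P \<or> b \<in> extension P"
      using tp sq ab unfolding extension_def by blast
  qed
qed

lemma krull_dim_ge:
  assumes P: "\<And>i. i \<le> n \<Longrightarrow> primeideal (P i) S \<and> I \<subseteq> P i \<and> P i \<inter> T = {}"
    and strict: "\<And>i. i < n \<Longrightarrow> P i \<subset> P (Suc i)"
  shows "enat n \<le> krull_dim L"
proof -
  have "\<forall>i\<le>n. primeideal (extension (P i)) L" using P extension_primeideal by blast
  moreover have "extension (P i) \<subset> extension (P (Suc i))" if i: "i < n" for i
  proof -
    obtain p where p: "p \<in> P (Suc i)" "p \<notin> P i" using strict[OF i] by blast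
    have Pi: "primeideal (P i) S" "I \<subseteq> P i" "P i \<inter> T = {}"
      and PSi: "primeideal (P (Suc i)) S" "I \<subseteq> P (Suc i)" "P (Suc i) \<inter> T = {}"
      using P[of i] P[of "Suc i"] i by auto
    have "p \<in> carrier S" using p(1) ideal.Icarr[OF primeideal.axioms(1)[OF PSi(1)]] by blast
    then have "\<pi> p \<in> extension (P (Suc i))" "\<pi> p \<notin> extension (P i)"
      using image_mem_extension_iff[OF Pi] image_mem_extension_iff[OF PSi] p by auto
    moreover have "extension (P i) \<subseteq> extension (P (Suc i))"
      using strict[OF i] unfolding extension_def by blast
    ultimately show ?thesis by blast
  qed
  ultimately have "\<exists>Q. (\<forall>i\<le>n. primeideal (Q i) L) \<and> (\<forall>i<n. Q i \<subset> Q (Suc i))"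
    by (intro exI[of _ "\<lambda>i. extension (P i)"]) simp
  then show ?thesis unfolding krull_dim_def by (intro Sup_upper CollectI exI[of _ n] conjI refl)
qed

text \<open>
  If the denominators are the complement of \<open>P\<close>, a fraction whose numerator is not in \<open>P\<close> can be
  inverted. Together with the next lemma: the extension of \<open>P\<close> lies in the Jacobson radical of \<open>L\<close>.
\<close>

lemma unit_of_not_mem_extension:
  assumes T: "T = carrier S - P" and z: "z \<in> carrier L" "z \<notin> extension P"
  shows "z \<in> Units L"
proof -
  obtain t p where tp: "t \<in> T" "p \<in> carrier S" "\<pi> t \<otimes>\<^bsub>L\<^esub> z = \<pi> p" using surj[OF z(1)] by blast
  then have "p \<notin> P" using z unfolding extension_def by blast
  then have "\<pi> p \<in> Units L" using tp(2) T unit by blast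
  then have "\<pi> t \<otimes>\<^bsub>L\<^esub> z \<in> Units L" using tp(3) by simp
  then show ?thesis using L.unit_factor[of z "\<pi> t"] L.m_comm[of z "\<pi> t"] z(1) T_closed[OF tp(1)] by simp
qed

lemma one_minus_unit:
  assumes T: "T = carrier S - P" and P: "primeideal P S" "I \<subseteq> P"
    and y: "y \<in> extension P" and a: "a \<in> carrier L"
  shows "\<one>\<^bsub>L\<^esub> \<ominus>\<^bsub>L\<^esub> a \<otimes>\<^bsub>L\<^esub> y \<in> Units L"
proof (rule unit_of_not_mem_extension[OF T])
  have "P \<inter> T = {}" unfolding T by blast
  then have E: "primeideal (extension P) L" by (rule extension_primeideal[OF P])
  interpret E: ideal "extension P" L by (rule primeideal.axioms(1)[OF E])
  have yc: "y \<in> carrier L" by (rule E.Icarr[OF y])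
  then show "\<one>\<^bsub>L\<^esub> \<ominus>\<^bsub>L\<^esub> a \<otimes>\<^bsub>L\<^esub> y \<in> carrier L" using a by simp
  show "\<one>\<^bsub>L\<^esub> \<ominus>\<^bsub>L\<^esub> a \<otimes>\<^bsub>L\<^esub> y \<notin> extension P"
  proof
    assume "\<one>\<^bsub>L\<^esub> \<ominus>\<^bsub>L\<^esub> a \<otimes>\<^bsub>L\<^esub> y \<in> extension P"
    then have "(\<one>\<^bsub>L\<^esub> \<ominus>\<^bsub>L\<^esub> a \<otimes>\<^bsub>L\<^esub> y) \<oplus>\<^bsub>L\<^esub> a \<otimes>\<^bsub>L\<^esub> y \<in> extension P"
      using E.I_l_closed[OF y a] by (rule E.a_closed)
    moreover have "(\<one>\<^bsub>L\<^esub> \<ominus>\<^bsub>L\<^esub> a \<otimes>\<^bsub>L\<^esub> y) \<oplus>\<^bsub>L\<^esub> a \<otimes>\<^bsub>L\<^esub> y = \<one>\<^bsub>L\<^esub>" using a yc by algebra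
    ultimately show False using E.one_imp_carrier primeideal.I_notcarr[OF E] by simp
  qed
qed

end

section \<open>Cohen--Macaulay edge rings are unmixed\<close>

lemma coordinate_prime_disjoint:
  "coordinate_prime V B \<inter> (carrier (polynomial_ring V) - coordinate_prime V {}) = {}"
  by (auto simp: coordinate_prime_def)

text \<open>
  The maximal ideal of the edge ring generated by the variables.
\<close>

definition irrelevant_ideal :: "'a pair_pre_digraph \<Rightarrow> (('a \<Rightarrow>\<^sub>0 nat) \<Rightarrow>\<^sub>0 'k::field) set set" where
  "irrelevant_ideal G = (+>\<^bsub>polynomial_ring (pverts G)\<^esub>) (edge_ideal G) ` coordinate_prime (pverts G) {}"

lemma irrelevant_ideal_maximal:
  assumes G: "pair_graph G"
  shows "maximalideal (irrelevant_ideal G) (edge_ring G :: (('a \<Rightarrow>\<^sub>0 nat) \<Rightarrow>\<^sub>0 'k::field) set ring)"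
proof -
  interpret S: cring "polynomial_ring (pverts G) :: (('a \<Rightarrow>\<^sub>0 nat) \<Rightarrow>\<^sub>0 'k) ring" by (rule cring_polynomial_ring)
  show ?thesis
    unfolding irrelevant_ideal_def edge_ring_def
    by (intro S.maximalideal_quot edge_ideal_ideal G maximalideal_coordinate_prime_empty
        edge_ideal_subset_coordinate_prime) (auto simp: empty_independent)
qed

definition edge_local_ring :: "'a pair_pre_digraph \<Rightarrow> ((('a \<Rightarrow>\<^sub>0 nat) \<Rightarrow>\<^sub>0 'k::field) set \<times> (('a \<Rightarrow>\<^sub>0 nat) \<Rightarrow>\<^sub>0 'k) set) set ring" where
  "edge_local_ring G = localization (edge_ring G) (carrier (edge_ring G) - irrelevant_ideal G)"

definition to_local :: "'a pair_pre_digraph \<Rightarrow> (('a \<Rightarrow>\<^sub>0 nat) \<Rightarrow>\<^sub>0 'k::field) \<Rightarrow> ((('a \<Rightarrow>\<^sub>0 nat) \<Rightarrow>\<^sub>0 'k) set \<times> (('a \<Rightarrow>\<^sub>0 nat) \<Rightarrow>\<^sub>0 'k) set) set" where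
  "to_local G p = fraction (edge_ring G) (carrier (edge_ring G) - irrelevant_ideal G)
     (edge_ideal G +>\<^bsub>polynomial_ring (pverts G)\<^esub> p) \<one>\<^bsub>edge_ring G\<^esub>"

context
  fixes G :: "'a pair_pre_digraph" and K :: "'k::field itself"
  assumes G: "pair_graph G"
begin

private abbreviation S :: "(('a \<Rightarrow>\<^sub>0 nat) \<Rightarrow>\<^sub>0 'k) ring" where "S \<equiv> polynomial_ring (pverts G)"
private abbreviation I :: "(('a \<Rightarrow>\<^sub>0 nat) \<Rightarrow>\<^sub>0 'k) set" where "I \<equiv> edge_ideal G"
private abbreviation R :: "(('a \<Rightarrow>\<^sub>0 nat) \<Rightarrow>\<^sub>0 'k) set ring" where "R \<equiv> edge_ring G"
private abbreviation U :: "(('a \<Rightarrow>\<^sub>0 nat) \<Rightarrow>\<^sub>0 'k) set set" where "U \<equiv> carrier R - irrelevant_ideal G"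
private abbreviation P0 :: "(('a \<Rightarrow>\<^sub>0 nat) \<Rightarrow>\<^sub>0 'k) set" where "P0 \<equiv> coordinate_prime (pverts G) {}"
private abbreviation cls :: "(('a \<Rightarrow>\<^sub>0 nat) \<Rightarrow>\<^sub>0 'k) \<Rightarrow> (('a \<Rightarrow>\<^sub>0 nat) \<Rightarrow>\<^sub>0 'k) set" where "cls p \<equiv> I +>\<^bsub>S\<^esub> p"

lemma I_sub_P0: "I \<subseteq> P0"
  by (rule edge_ideal_subset_coordinate_prime[OF G]) (auto simp: empty_independent)

lemma cring_edge_ring: "cring R"
  unfolding edge_ring_def by (rule ideal.quotient_is_cring[OF edge_ideal_ideal[OF G] cring_polynomial_ring])

lemma cls_hom: "cls \<in> ring_hom S R"
  unfolding edge_ring_def by (rule ideal.rcos_ring_hom[OF edge_ideal_ideal[OF G]])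

lemma cls_mem_U: "p \<in> carrier S \<Longrightarrow> cls p \<in> U \<longleftrightarrow> p \<notin> P0"
proof -
  assume p: "p \<in> carrier S"
  interpret S: cring S by (rule cring_polynomial_ring)
  have "ideal P0 S" by (rule maximalideal.axioms(1)[OF maximalideal_coordinate_prime_empty])
  then have "cls p \<in> irrelevant_ideal G \<longleftrightarrow> p \<in> P0"
    unfolding irrelevant_ideal_def by (rule S.mem_image_quot_iff[OF edge_ideal_ideal[OF G] _ I_sub_P0 p])
  then show ?thesis using ring_hom_closed[OF cls_hom p] by simp
qed

lemma edge_ringE:
  assumes "x \<in> carrier R"
  obtains p where "p \<in> carrier S" "x = cls p"
proof -
  interpret S: cring S by (rule cring_polynomial_ring)
  show ?thesis using assms that unfolding edge_ring_def by (rule S.carrier_quotE)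
qed

lemma multiplicative_set_U: "multiplicative_set R U"
proof -
  interpret R: cring R by (rule cring_edge_ring)
  have "primeideal (irrelevant_ideal G) R" by (rule R.maximalideal_prime[OF irrelevant_ideal_maximal[OF G]])
  then interpret M: primeideal "irrelevant_ideal G" R .
  show ?thesis
  proof unfold_locales
    show "\<one>\<^bsub>R\<^esub> \<in> U" using M.one_imp_carrier M.I_notcarr by auto
    show "s \<otimes>\<^bsub>R\<^esub> t \<in> U" if "s \<in> U" "t \<in> U" for s t using that M.I_prime[of s t] by auto
  qed blast
qed

text \<open>
  The ring axioms of the localization enter as a hypothesis; for a Gorenstein edge ring they are part of
  the assertion that its localizations are local rings.
\<close>

lemma edge_localization_map:
  assumes L: "cring (edge_local_ring G :: ((('a \<Rightarrow>\<^sub>0 nat) \<Rightarrow>\<^sub>0 'k) set \<times> (('a \<Rightarrow>\<^sub>0 nat) \<Rightarrow>\<^sub>0 'k) set) set ring)"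
  shows "localization_map S (edge_local_ring G) (to_local G) (carrier S - P0) I"
proof -
  interpret S: cring S by (rule cring_polynomial_ring)
  interpret L: cring "edge_local_ring G :: ((('a \<Rightarrow>\<^sub>0 nat) \<Rightarrow>\<^sub>0 'k) set \<times> (('a \<Rightarrow>\<^sub>0 nat) \<Rightarrow>\<^sub>0 'k) set) set ring" by (rule L)
  interpret R: multiplicative_set R U by (rule multiplicative_set_U)
  interpret I: ideal I S by (rule edge_ideal_ideal[OF G])
  interpret P: primeideal P0 S by (rule coordinate_prime_primeideal) simp
  have zero_cls: "\<zero>\<^bsub>R\<^esub> = cls 0" "cls p = \<zero>\<^bsub>R\<^esub> \<longleftrightarrow> p \<in> I" if "p \<in> carrier S" for p
  proof -
    show 0: "\<zero>\<^bsub>R\<^esub> = cls 0"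
      using S.a_rcos_zero[OF I.is_ideal I.zero_closed] by (simp add: edge_ring_def FactRing_def)
    have "cls p = cls 0 \<longleftrightarrow> p \<in> I"
      using S.quotient_eq_iff_same_a_r_cos[OF I.is_ideal that S.zero_closed] that by (simp add: a_minus_def S.minus_zero[simplified])
    then show "cls p = \<zero>\<^bsub>R\<^esub> \<longleftrightarrow> p \<in> I" using 0 by simp
  qed
  have cls_closed: "cls p \<in> carrier R" if "p \<in> carrier S" for p using ring_hom_closed[OF cls_hom that] .
  have cls_mult: "cls (p * q) = cls p \<otimes>\<^bsub>R\<^esub> cls q" if "p \<in> carrier S" "q \<in> carrier S" for p q
    using ring_hom_mult[OF cls_hom that] by simp
  show ?thesis
  proof
    have "(\<lambda>a. fraction R U a \<one>\<^bsub>R\<^esub>) \<circ> cls \<in> ring_hom S (localization R U)"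
      by (rule ring_hom_trans[OF cls_hom R.localization_hom])
    then show "to_local G \<in> ring_hom S (edge_local_ring G)"
      by (simp add: to_local_def[abs_def] edge_local_ring_def comp_def)
    show "carrier S - P0 \<subseteq> carrier S" by blast
    show "\<one>\<^bsub>S\<^esub> \<in> carrier S - P0" using S.one_closed P.one_imp_carrier P.I_notcarr by blast
    show "s \<otimes>\<^bsub>S\<^esub> t \<in> carrier S - P0" if "s \<in> carrier S - P0" "t \<in> carrier S - P0" for s t
      using that P.I_prime[of s t] S.m_closed[of s t] by auto
    show "to_local G t \<in> Units (edge_local_ring G)" if t: "t \<in> carrier S - P0" for t
    proof -
      have U: "cls t \<in> U" using cls_mem_U[of t] t by blast
      then have "fraction R U (cls t) \<one>\<^bsub>R\<^esub> \<otimes>\<^bsub>localization R U\<^esub> fraction R U \<one>\<^bsub>R\<^esub> (cls t) = \<one>\<^bsub>localization R U\<^esub>"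
        by (rule R.fraction_inverse)
      then have "to_local G t \<otimes>\<^bsub>edge_local_ring G\<^esub> fraction R U \<one>\<^bsub>R\<^esub> (cls t) = \<one>\<^bsub>edge_local_ring G\<^esub>"
        unfolding to_local_def edge_local_ring_def .
      moreover have "to_local G t \<in> carrier (edge_local_ring G)"
        "fraction R U \<one>\<^bsub>R\<^esub> (cls t) \<in> carrier (edge_local_ring G)"
        unfolding to_local_def edge_local_ring_def
        by (rule R.fraction_carrier; use U R.S_one in blast)+
      ultimately show ?thesis
        by (intro L.unit_factor[of "to_local G t" "fraction R U \<one>\<^bsub>R\<^esub> (cls t)"]) simp_all
    qed
    show "to_local G p = \<zero>\<^bsub>edge_local_ring G\<^esub>" if p: "p \<in> I" for p
      using zero_cls(2)[OF I.Icarr[OF p]] p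
      by (simp add: to_local_def edge_local_ring_def R.zero_localization)
    show "\<exists>t\<in>carrier S - P0. t \<otimes>\<^bsub>S\<^esub> p \<in> I"
      if p: "p \<in> carrier S" and z: "to_local G p = \<zero>\<^bsub>edge_local_ring G\<^esub>" for p
    proof -
      have "fraction R U (cls p) \<one>\<^bsub>R\<^esub> = fraction R U \<zero>\<^bsub>R\<^esub> \<one>\<^bsub>R\<^esub>"
        using z by (simp add: to_local_def edge_local_ring_def R.zero_localization)
      then obtain u where u: "u \<in> U" "u \<otimes>\<^bsub>R\<^esub> (\<one>\<^bsub>R\<^esub> \<otimes>\<^bsub>R\<^esub> cls p) = u \<otimes>\<^bsub>R\<^esub> (\<one>\<^bsub>R\<^esub> \<otimes>\<^bsub>R\<^esub> \<zero>\<^bsub>R\<^esub>)"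
        using R.fraction_eq_iff[OF cls_closed[OF p] R.S_one R.zero_closed R.S_one] by blast
      have uc: "u \<in> carrier R" using u(1) by blast
      then obtain t where t: "t \<in> carrier S" "u = cls t" by (rule edge_ringE)
      have "cls (t * p) = \<zero>\<^bsub>R\<^esub>" using u(2) uc cls_closed[OF p] t cls_mult[OF t(1) p] by simp
      then have "t * p \<in> I" using zero_cls(2)[of "t * p"] S.m_closed[OF t(1) p] by simp
      then show ?thesis using t u(1) cls_mem_U[OF t(1)] \<open>t * p \<in> I\<close> by auto
    qed
    show "\<exists>t\<in>carrier S - P0. \<exists>p\<in>carrier S. to_local G t \<otimes>\<^bsub>edge_local_ring G\<^esub> z = to_local G p"
      if z: "z \<in> carrier (edge_local_ring G)" for z
    proof -
      obtain a s where as: "a \<in> carrier R" "s \<in> U" "z = fraction R U a s"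
        using z unfolding edge_local_ring_def by (rule R.carrier_localizationE)
      obtain p where p: "p \<in> carrier S" "a = cls p" using as(1) by (rule edge_ringE)
      have sc: "s \<in> carrier R" using as(2) by blast
      then obtain t where t: "t \<in> carrier S" "s = cls t" by (rule edge_ringE)
      have "fraction R U s \<one>\<^bsub>R\<^esub> \<otimes>\<^bsub>localization R U\<^esub> fraction R U a s = fraction R U a \<one>\<^bsub>R\<^esub>"
        by (rule R.clear_denominator) (fact as)+
      then have "to_local G t \<otimes>\<^bsub>edge_local_ring G\<^esub> z = to_local G p"
        unfolding to_local_def edge_local_ring_def as(3) p(2) t(2) .
      moreover have "t \<in> carrier S - P0" using as(2) t cls_mem_U[OF t(1)] by blast
      ultimately show ?thesis using p(1) by blast
    qed
  qed
qed

text \<open>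
  Brings the maximal ideal of the local ring, in which regular sequences are taken, into the form of
  fractions with numerator in \<open>P0\<close>, to which the Jacobson radical argument applies.
\<close>

lemma extended_ideal_subset_extension:
  assumes L: "cring (edge_local_ring G :: ((('a \<Rightarrow>\<^sub>0 nat) \<Rightarrow>\<^sub>0 'k) set \<times> (('a \<Rightarrow>\<^sub>0 nat) \<Rightarrow>\<^sub>0 'k) set) set ring)"
  shows "extended_ideal R U (irrelevant_ideal G)
    \<subseteq> localization_map.extension (edge_local_ring G) (to_local G) (carrier S - P0) P0"
proof
  interpret localization_map S "edge_local_ring G" "to_local G" "carrier S - P0" I
    by (rule edge_localization_map[OF L])
  interpret R: multiplicative_set R U by (rule multiplicative_set_U)
  fix z assume "z \<in> extended_ideal R U (irrelevant_ideal G)"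
  then obtain a s where as: "a \<in> irrelevant_ideal G" "s \<in> U" "z = fraction R U a s"
    by (auto simp: extended_ideal_def)
  obtain p where p: "p \<in> P0" "a = cls p" using as(1) by (auto simp: irrelevant_ideal_def)
  have pc: "p \<in> carrier S" using p(1) by (simp add: coordinate_prime_def)
  have ac: "a \<in> carrier R" using ring_hom_closed[OF cls_hom pc] p(2) by simp
  have sc: "s \<in> carrier R" using as(2) by blast
  then obtain t where t: "t \<in> carrier S" "s = cls t" by (rule edge_ringE)
  have "fraction R U s \<one>\<^bsub>R\<^esub> \<otimes>\<^bsub>localization R U\<^esub> fraction R U a s = fraction R U a \<one>\<^bsub>R\<^esub>"
    by (rule R.clear_denominator) (fact ac as)+
  then have "to_local G t \<otimes>\<^bsub>edge_local_ring G\<^esub> z = to_local G p"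
    unfolding to_local_def edge_local_ring_def as(3) p(2) t(2) .
  moreover have "t \<in> carrier S - P0" using as(2) t cls_mem_U[OF t(1)] by blast
  moreover have "z \<in> carrier (edge_local_ring G)"
    unfolding edge_local_ring_def as(3) by (rule R.fraction_carrier[OF ac as(2)])
  ultimately show "z \<in> extension P0" using p(1) unfolding extension_def by blast
qed

lemma finsum_polynomial_ring:
  assumes "finite E" and "\<And>e. e \<in> E \<Longrightarrow> h e \<in> carrier S"
  shows "finsum S h E = sum h E"
  using assms
proof (induction E rule: finite_induct)
  case empty
  interpret S: cring S by (rule cring_polynomial_ring)
  show ?case by simp
next
  case (insert e E)
  interpret S: cring S by (rule cring_polynomial_ring)
  have "finsum S h (insert e E) = h e \<oplus>\<^bsub>S\<^esub> finsum S h E"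
    using insert by (intro S.finsum_insert) auto
  then show ?case using insert by simp
qed

text \<open>
  After clearing denominators, a regular sequence with more than \<open>|F|\<close> members satisfies a polynomial
  relation modulo the prime of \<open>F\<close>. That prime annihilates the image of \<open>x = \<Prod>\<^sub>u\<^sub>\<in>\<^sub>F x\<^sub>u\<close>, which is
  nonzero in \<open>L\<close>: a multiple \<open>t x\<close> in the edge ideal would lie in the prime of \<open>F\<close>, which contains neither
  \<open>x\<close> nor a polynomial \<open>t\<close> with nonzero constant term. This contradicts the independence of regular
  sequences. The coefficients of the relation are nonzero constants times powers of denominators, hence
  units.
\<close>

lemma length_regular_sequence_le:
  fixes L :: "((('a \<Rightarrow>\<^sub>0 nat) \<Rightarrow>\<^sub>0 'k) set \<times> (('a \<Rightarrow>\<^sub>0 nat) \<Rightarrow>\<^sub>0 'k) set) set ring"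
  defines "L \<equiv> edge_local_ring G"
  assumes L: "cring L" "noetherian_ring L"
    and F: "F \<in> independent_sets G"
    and maximal: "\<And>w. w \<in> pverts G - F \<Longrightarrow> \<exists>u\<in>F. (u, w) \<in> parcs G"
    and ys: "set ys \<subseteq> extended_ideal R U (irrelevant_ideal G)" "regular_sequence L ys"
  shows "length ys \<le> card F"
proof (rule ccontr)
  assume "\<not> length ys \<le> card F"
  then have long: "card F < length ys" by simp
  have FV: "F \<subseteq> pverts G" using F by (simp add: independent_sets_def)
  have finF: "finite F" using FV finite_pverts[OF G] by (rule finite_subset)
  interpret S: cring S by (rule cring_polynomial_ring)
  interpret L: cring L by (rule L(1))
  interpret loc: localization_map S L "to_local G" "carrier S - P0" I
    unfolding L_def by (rule edge_localization_map) (use L in \<open>simp add: L_def\<close>)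
  interpret P: primeideal "coordinate_prime (pverts G) F" S by (rule coordinate_prime_primeideal[OF finF])
  interpret P0: primeideal P0 S by (rule coordinate_prime_primeideal) simp
  have ys_ext: "y \<in> loc.extension P0" if "y \<in> set ys" for y
    using extended_ideal_subset_extension L(1) ys(1) that unfolding L_def by blast
  have ysc: "set ys \<subseteq> carrier L" using ys_ext unfolding loc.extension_def by blast
  have "\<exists>t p. t \<in> carrier S - P0 \<and> p \<in> P0 \<and> to_local G t \<otimes>\<^bsub>L\<^esub> y = to_local G p" if "y \<in> set ys" for y
    using ys_ext[OF that] unfolding loc.extension_def by blast
  then obtain den num where den: "\<And>y. y \<in> set ys \<Longrightarrow> den y \<in> carrier S - P0"
    and num: "\<And>y. y \<in> set ys \<Longrightarrow> num y \<in> P0"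
    and frac: "\<And>y. y \<in> set ys \<Longrightarrow> to_local G (den y) \<otimes>\<^bsub>L\<^esub> y = to_local G (num y)"
    by metis
  define ps where "ps = map num ys"
  have ps: "set ps \<subseteq> carrier S" unfolding ps_def using num P0.Icarr by auto
  have len: "length ps = length ys" by (simp add: ps_def)
  have long': "card F < length ps" using long len by simp
  obtain E c where E: "finite E" "E \<noteq> {}" "\<And>e. e \<in> E \<Longrightarrow> length e = length ps"
    and c: "\<And>e. e \<in> E \<Longrightarrow> c e \<noteq> 0"
    and q: "(\<Sum>e\<in>E. Poly_Mapping.single 0 (c e) * power_product S ps e) \<in> coordinate_prime (pverts G) F"
    by (rule algebraic_dependence[OF finF ps long']) blast
  define C where "C = (\<lambda>e. Poly_Mapping.single 0 (c e) :: ('a \<Rightarrow>\<^sub>0 nat) \<Rightarrow>\<^sub>0 'k)"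
  define q where "q = (\<Sum>e\<in>E. C e * power_product S ps e)"
  have Cc: "C e \<in> carrier S" for e unfolding C_def by (rule single_carrier) simp
  have pc: "power_product S ps e \<in> carrier S" for e by (rule S.power_product_closed[OF ps])
  have tc: "C e * power_product S ps e \<in> carrier S" for e using S.m_closed[OF Cc pc] by simp
  define x where "x = (squarefree_monomial F :: ('a \<Rightarrow>\<^sub>0 nat) \<Rightarrow>\<^sub>0 'k)"
  have x: "x \<in> carrier S" unfolding x_def by (rule squarefree_monomial_carrier[OF finF FV])
  have qP: "q \<in> coordinate_prime (pverts G) F" using q by (simp add: q_def C_def)
  then have qc: "q \<in> carrier S" by (rule P.Icarr)
  have "q * x \<in> I"
    unfolding x_def by (rule coordinate_prime_mult_squarefree_monomial[OF G finF FV maximal qP])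
  then have "to_local G (q * x) = \<zero>\<^bsub>L\<^esub>" by (rule loc.zero)
  then have qx: "to_local G q \<otimes>\<^bsub>L\<^esub> to_local G x = \<zero>\<^bsub>L\<^esub>"
    using loc.h.hom_mult[OF qc x] by simp
  have fx: "to_local G x \<in> carrier L" using x by (rule loc.h.hom_closed)
  have x_ne: "to_local G x \<noteq> \<zero>\<^bsub>L\<^esub>"
  proof
    assume "to_local G x = \<zero>\<^bsub>L\<^esub>"
    then obtain t where t: "t \<in> carrier S - P0" "t \<otimes>\<^bsub>S\<^esub> x \<in> I" using loc.kernel[OF x] by blast
    moreover have "I \<subseteq> coordinate_prime (pverts G) F"
      by (rule edge_ideal_subset_coordinate_prime[OF G F finF])
    ultimately have "t * x \<in> coordinate_prime (pverts G) F" by auto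
    moreover have "t \<notin> coordinate_prime (pverts G) F" using t(1) coordinate_prime_disjoint by blast
    ultimately have "x \<in> coordinate_prime (pverts G) F" using P.I_prime[of t x] t(1) x by auto
    then show False unfolding x_def using squarefree_monomial_notin[OF finF] by blast
  qed
  define d where "d = (\<lambda>e. to_local G (C e) \<otimes>\<^bsub>L\<^esub> power_product L (map (\<lambda>y. to_local G (den y)) ys) e)"
  have C_unit: "to_local G (C e) \<in> Units L" if "e \<in> E" for e
  proof (rule loc.unit)
    show "C e \<in> carrier S - P0" using Cc[of e] c[OF that] by (simp add: mem_coordinate_prime_empty C_def)
  qed
  have d_unit: "d e \<in> Units L" if "e \<in> E" for e
    unfolding d_def using C_unit[OF that] den loc.unit by (intro L.Units_m_closed L.power_product_Units) auto
  have tm: "to_local G (C e * power_product S ps e) = d e \<otimes>\<^bsub>L\<^esub> power_product L ys e" for e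
  proof -
    have den_c: "to_local G (den y) \<in> carrier L" if "y \<in> set ys" for y
      using den[OF that] by (intro loc.h.hom_closed) blast
    have "map (to_local G) ps = map (\<lambda>y. to_local G (den y) \<otimes>\<^bsub>L\<^esub> y) ys"
      using frac by (simp add: ps_def)
    then have "to_local G (power_product S ps e)
      = power_product L (map (\<lambda>y. to_local G (den y)) ys) e \<otimes>\<^bsub>L\<^esub> power_product L ys e"
      using loc.h.power_product_hom[OF ps] L.power_product_mult[of ys "\<lambda>y. to_local G (den y)"] den_c ysc by simp
    moreover have "power_product L (map (\<lambda>y. to_local G (den y)) ys) e \<in> carrier L"
      "power_product L ys e \<in> carrier L"
      using den_c ysc by (auto intro!: L.power_product_closed)
    moreover have "to_local G (C e * power_product S ps e) = to_local G (C e) \<otimes>\<^bsub>L\<^esub> to_local G (power_product S ps e)"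
      using loc.h.hom_mult[OF Cc pc] by simp
    moreover have "to_local G (C e) \<in> carrier L" using Cc by (rule loc.h.hom_closed)
    ultimately show ?thesis by (simp add: d_def L.m_assoc)
  qed
  have "to_local G q = (\<Oplus>\<^bsub>L\<^esub>e\<in>E. to_local G (C e * power_product S ps e))"
    unfolding q_def finsum_polynomial_ring[OF E(1) tc, symmetric]
    using loc.h.hom_finsum[of "\<lambda>e. C e * power_product S ps e" E] tc by (simp add: comp_def)
  then have "to_local G q = (\<Oplus>\<^bsub>L\<^esub>e\<in>E. d e \<otimes>\<^bsub>L\<^esub> power_product L ys e)" unfolding tm .
  moreover have "(\<Oplus>\<^bsub>L\<^esub>e\<in>E. d e \<otimes>\<^bsub>L\<^esub> power_product L ys e) \<otimes>\<^bsub>L\<^esub> to_local G x \<notin> {\<zero>\<^bsub>L\<^esub>}"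
  proof (rule L.regular_modulo_independent[OF L(2) _ L.zeroideal ysc _ fx _ E(1,2)])
    have "Idl\<^bsub>L\<^esub> {} = {\<zero>\<^bsub>L\<^esub>}"
    proof
      show "Idl\<^bsub>L\<^esub> {} \<subseteq> {\<zero>\<^bsub>L\<^esub>}" by (rule L.genideal_minimal[OF L.zeroideal]) simp
      have "ideal (Idl\<^bsub>L\<^esub> {}) L" by (rule L.genideal_ideal) simp
      then show "{\<zero>\<^bsub>L\<^esub>} \<subseteq> Idl\<^bsub>L\<^esub> {}" using additive_subgroup.zero_closed[OF ideal.axioms(1)] by blast
    qed
    then show "regular_modulo L {\<zero>\<^bsub>L\<^esub>} ys"
      using L.regular_modulo_of_regular_sequence[of "[]" ys] ys(2) by simp
    show "\<one>\<^bsub>L\<^esub> \<ominus>\<^bsub>L\<^esub> a \<otimes>\<^bsub>L\<^esub> y \<in> Units L" if "y \<in> set ys" "a \<in> carrier L" for y a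
      by (rule loc.one_minus_unit[OF refl P0.primeideal I_sub_P0 ys_ext[OF that(1)] that(2)])
    show "to_local G x \<notin> {\<zero>\<^bsub>L\<^esub>}" using x_ne by simp
    show "length e = length ys" if "e \<in> E" for e using E(3)[OF that] len by simp
    show "d e \<in> Units L" if "e \<in> E" for e by (rule d_unit[OF that])
  qed
  ultimately show False using qx by simp
qed

text \<open>
  Enumerate \<open>A\<close> and let \<open>B i\<close> omit its first \<open>i\<close> elements. The primes of the independent sets \<open>B i\<close> form
  a strictly increasing chain of length \<open>|A|\<close>.
\<close>

lemma card_le_krull_dim:
  fixes L :: "((('a \<Rightarrow>\<^sub>0 nat) \<Rightarrow>\<^sub>0 'k) set \<times> (('a \<Rightarrow>\<^sub>0 nat) \<Rightarrow>\<^sub>0 'k) set) set ring"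
  defines "L \<equiv> edge_local_ring G"
  assumes L: "cring L" and A: "A \<in> independent_sets G"
  shows "enat (card A) \<le> krull_dim L"
proof -
  interpret loc: localization_map S L "to_local G" "carrier S - P0" I
    unfolding L_def by (rule edge_localization_map) (use L in \<open>simp add: L_def\<close>)
  have AV: "A \<subseteq> pverts G" using A by (simp add: independent_sets_def)
  have finA: "finite A" using AV finite_pverts[OF G] by (rule finite_subset)
  obtain h where h: "bij_betw h {0..<card A} A" using ex_bij_betw_nat_finite[OF finA] by blast
  define B where "B = (\<lambda>i. h ` {i..<card A})"
  have BA: "B i \<subseteq> A" for i using h by (auto simp: B_def bij_betw_def)
  have B_ind: "B i \<in> independent_sets G" for i using A BA[of i] unfolding independent_sets_def by blast
  have finB: "finite (B i)" for i by (simp add: B_def)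
  show ?thesis
  proof (rule loc.krull_dim_ge[where P = "\<lambda>i. coordinate_prime (pverts G) (B i)"])
    show "primeideal (coordinate_prime (pverts G) (B i)) S \<and> I \<subseteq> coordinate_prime (pverts G) (B i) \<and>
        coordinate_prime (pverts G) (B i) \<inter> (carrier S - P0) = {}" for i
      using coordinate_prime_primeideal[OF finB] edge_ideal_subset_coordinate_prime[OF G B_ind finB]
        coordinate_prime_disjoint by blast
    show "coordinate_prime (pverts G) (B i) \<subset> (coordinate_prime (pverts G) (B (Suc i)) :: (('a \<Rightarrow>\<^sub>0 nat) \<Rightarrow>\<^sub>0 'k) set)"
      if i: "i < card A" for i
    proof (rule coordinate_prime_strict_antimono)
      have "h i \<notin> B (Suc i)" using h i unfolding B_def bij_betw_def
        by (auto dest: inj_onD[of h "{0..<card A}" i])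
      moreover have "h i \<in> B i" "B (Suc i) \<subseteq> B i" using i by (auto simp: B_def)
      ultimately show "B (Suc i) \<subset> B i" by blast
      show "B i \<subseteq> pverts G" using BA AV by blast
    qed
  qed
qed

text \<open>
  Cohen--Macaulayness at the irrelevant ideal gives \<open>|A| \<le> dim L = depth L \<le> |F|\<close>.
\<close>

theorem gorenstein_well_covered:
  assumes gor: "gorenstein_over K G"
    and F: "F \<in> independent_sets G"
    and maximal: "\<And>w. w \<in> pverts G - F \<Longrightarrow> \<exists>u\<in>F. (u, w) \<in> parcs G"
    and A: "A \<in> independent_sets G"
  shows "card A \<le> card F"
proof (rule ccontr)
  assume "\<not> card A \<le> card F"
  then have less: "enat (card F) < enat (card A)" by simp
  let ?L = "edge_local_ring G :: ((('a \<Rightarrow>\<^sub>0 nat) \<Rightarrow>\<^sub>0 'k) set \<times> (('a \<Rightarrow>\<^sub>0 nat) \<Rightarrow>\<^sub>0 'k) set) set ring"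
  let ?M = "extended_ideal R U (irrelevant_ideal G)"
  have "maximalideal (irrelevant_ideal G) R" by (rule irrelevant_ideal_maximal[OF G])
  then have "gorenstein_local_ring ?L ?M"
    using gor unfolding gorenstein_over_def gorenstein_ring_def edge_local_ring_def by blast
  then have cm: "noetherian_ring ?L" "local_ring ?L ?M" "depth ?L ?M = krull_dim ?L"
    by (auto simp: gorenstein_local_ring_def cohen_macaulay_local_ring_def)
  have cr: "cring ?L" using cm(2) by (simp add: local_ring_def)
  have "enat (card F) < depth ?L ?M"
    unfolding cm(3) by (rule less_le_trans[OF less card_le_krull_dim[OF cr A]])
  then obtain ys where ys: "set ys \<subseteq> ?M" "regular_sequence ?L ys" "enat (card F) < enat (length ys)"
    unfolding depth_def less_Sup_iff by blast
  have "length ys \<le> card F" by (rule length_regular_sequence_le[OF cr cm(1) F maximal ys(1,2)])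
  then show False using ys(3) by simp
qed

end

section \<open>The Charney--Davis inequality for the Trung construction\<close>

text \<open>
  Adding \<open>v\<close> to a maximum independent set of \<open>H\<^sub>v\<close> yields a maximal independent set of \<open>H\<close>: a vertex that
  could still be added would be a vertex of \<open>H\<^sub>v\<close>. In a well-covered graph it is therefore maximum.
\<close>

lemma independence_number_delete_closed_nbhd:
  assumes G: "pair_graph H" and v: "v \<in> pverts H" and gor: "gorenstein_over K H"
  shows "independence_number H = Suc (independence_number (delete_closed_nbhd H v))"
proof -
  let ?Hv = "delete_closed_nbhd H v"
  have fin: "finite (pverts H)" by (rule finite_pverts[OF G])
  then have finv: "finite (pverts ?Hv)" by (simp add: delete_closed_nbhd_def Let_def)
  obtain B where B: "B \<in> independent_sets ?Hv" "card B = independence_number ?Hv"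
    by (rule obtain_maximum_independent[OF finv])
  have B_sub: "B \<subseteq> pverts ?Hv" using B(1) by (simp add: independent_sets_def)
  then have vB: "v \<notin> B" "finite B" using finv by (auto simp: delete_closed_nbhd_def Let_def intro: finite_subset)
  let ?F = "insert v B"
  have F: "?F \<in> independent_sets H" using independent_containing[OF G v] B(1) by blast
  have cardF: "card ?F = Suc (independence_number ?Hv)" using vB B(2) by simp
  have maximal: "\<exists>u\<in>?F. (u, w) \<in> parcs H" if w: "w \<in> pverts H - ?F" for w
  proof (rule ccontr)
    assume none: "\<not> (\<exists>u\<in>?F. (u, w) \<in> parcs H)"
    then have none': "\<And>u. u \<in> ?F \<Longrightarrow> (u, w) \<notin> parcs H \<and> (w, u) \<notin> parcs H"
      using arc_sym[OF G] by blast
    then have "insert w ?F \<in> independent_sets H"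
      using F w arc_neq[OF G] by (auto simp: independent_sets_def)
    then have "insert w B \<in> independent_sets ?Hv"
      using w none' vB(1) B(1) unfolding independent_sets_delete_closed_nbhd
      by (auto simp: independent_avoiding_def independent_sets_def neighbours_def)
    then have "card (insert w B) \<le> independence_number ?Hv" by (rule card_le_independence_number[OF finv])
    then show False using w vB(2) B(2) by simp
  qed
  obtain A where A: "A \<in> independent_sets H" "card A = independence_number H"
    by (rule obtain_maximum_independent[OF fin])
  have "card A \<le> card ?F" by (rule gorenstein_well_covered[OF G gor F maximal A(1)])
  moreover have "card ?F \<le> independence_number H" by (rule card_le_independence_number[OF fin F])
  ultimately show ?thesis using A(2) cardF by simp
qed

theorem corollary3p7:
  fixes H :: "'a pair_pre_digraph" and v :: 'a
  assumes "pair_graph H"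
    and "no_isolated_vertices H"
    and "gorenstein_over TYPE(rat) H"
    and "odd (independence_number H)"
    and "v \<in> pverts H"
  shows "even (independence_number (trung H v)) \<and>
         even (independence_number (delete_closed_nbhd H v)) \<and>
         (satisfies_charney_davis (trung H v) \<longleftrightarrow>
          satisfies_charney_davis (delete_closed_nbhd H v))"
proof -
  let ?G = "trung H v" and ?Hv = "delete_closed_nbhd H v"
  have G: "independence_number ?G = Suc (independence_number H)"
    by (rule independence_number_trung[OF assms(1,5)])
  have Hv: "independence_number H = Suc (independence_number ?Hv)"
    by (rule independence_number_delete_closed_nbhd[OF assms(1,5,3)])
  have even: "even (independence_number ?G)" "even (independence_number ?Hv)"
    using assms(4) G Hv by auto
  have "independence_number ?G div 2 = Suc (independence_number ?Hv div 2)" using G Hv by simp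
  moreover have "poly (independence_poly ?G) (-1/2) = - (1/4) * poly (independence_poly ?Hv) (-1/2)"
    using independence_poly_trung[OF assms(1,5), of "-1/2"] by simp
  ultimately have "(-1) ^ (independence_number ?G div 2) * poly (independence_poly ?G) (-1/2)
      = (1/4) * ((-1) ^ (independence_number ?Hv div 2) * poly (independence_poly ?Hv) (-1/2))"
      (is "?x = (1/4) * ?y")
    by simp
  then have "0 \<le> ?x \<longleftrightarrow> 0 \<le> ?y" by linarith
  then show ?thesis using even unfolding satisfies_charney_davis_def by blast
qed

end
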